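(* Let $\mathcal G(\partial_1,\ldots,\partial_n)$ be an $m\times m$ matrix whose entries are partial differential operators on $\mathbb R^n$ with constant complex coefficients, such that $$\sup\{\operatorname{Re}\lambda:\lambda\in\sigma(\mathcal G(i\xi)),\ \xi\in\mathbb R^n\}<\infty ,$$ and let $(S_t)_{t\ge0}\subset\mathcal O'_C(\mathbb R^n;M_{m\times m})$ be the unique i.d.c.s. with generating distribution $\mathcal G(\partial_1,\ldots,\partial_n)\otimes\delta$. Let $E$ be a sequentially complete locally convex vector space continuously imbedded in $\mathcal S'(\mathbb R^n;\mathbb C^m)$ such that $(S_t\,* )E\subset E$ for every $t\in[0,\infty)$ and the mapping $[0,\infty)\times E\ni(t,u)\mapsto S_t*u\in E$ is separately continuous. Then for every $k=1,2,\ldots,\infty$ and every $u_0\in D(\mathcal G_E^k)$ the Cauchy problem $$\frac{d}{dt}u(t)=\mathcal G(\partial_1,\ldots,\partial_n)u(t)\quad\text{for }t\in[0,\infty),\qquad u(0)=u_0,$$ has a solution $u(\cdot)\in C^k([0,\infty);E)$ which is unique in the class $C^1([0,\infty);\mathcal S'(\mathbb R^n;\mathbb C^m))$. This solution is given by the formula $$u(t)=S_t*u_0\quad\text{for }t\in[0,\infty).$$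
   Context: $M_{m\times m}$ is the set of $m\times m$ complex matrices; $\sigma(B)$ is the spectrum of $B\in M_{m\times m}$. $\partial_1,\ldots,\partial_n$ are the first order partial derivatives on $\mathbb R^n$; $\mathcal G(\zeta_1,\ldots,\zeta_n)$ is the matrix of polynomials obtained by replacing $\partial_k$ by $\zeta_k\in\mathbb C$, and $\mathcal G(i\xi)=\mathcal G(i\xi_1,\ldots,i\xi_n)$; $\delta$ is the Dirac distribution on $\mathbb R^n$, and $\mathcal G(\partial_1,\ldots,\partial_n)\otimes\delta$ is the matrix of distributions with entries $\mathcal G_{j,k}(\partial_1,\ldots,\partial_n)\delta$. $\mathcal S(\mathbb R^n)$ is the Schwartz space; $\mathcal S'(\mathbb R^n;\mathbb C^m)$ is the space of $\mathbb C^m$-valued tempered distributions, with the usual (strong dual) topology. $\mathcal O'_C(\mathbb R^n)$ is the space of rapidly decreasing distributions: $T\in\mathcal D'(\mathbb R^n)$ such that for every $k\in\mathbb N_0$ there is $m_k\in\mathbb N_0$ with $T=\sum_{|\alpha|\le m_k}\partial^\alpha f_{k,\alpha}$, where the $f_{k,\alpha}$ are continuous and $f_{k,\alpha}(x)=O(|x|^{-k})$ as $|x|\to\infty$. Equivalently, $\mathcal O'_C(\mathbb R^n)=\{T\in\mathcal S'(\mathbb R^n):T*\varphi\in\mathcal S(\mathbb R^n)\ \forall\varphi\in\mathcal S(\mathbb R^n)\}$. It is a convolution algebra. Its topology is the one induced, via $T\mapsto (T* )|_{\mathcal S(\mathbb R^n)}$, by the space $L(\mathcal S(\mathbb R^n);\mathcal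 S(\mathbb R^n))$ of continuous linear operators with the compact-open topology. Elements of $\mathcal O'_C(\mathbb R^n)$ can be convolved with elements of $\mathcal S'(\mathbb R^n)$, the result being in $\mathcal S'(\mathbb R^n)$, with $\mathscr F(T*u)=(\mathscr F T)\cdot(\mathscr F u)$, $\mathscr F$ denoting the Fourier transformation. $\mathcal O'_C(\mathbb R^n;M_{m\times m})$ is the space of $m\times m$ matrices with entries in $\mathcal O'_C(\mathbb R^n)$, with the topology of $\mathcal O'_C(\mathbb R^n)^{m^2}$ and the convolution $S*T=(\sum_{j}S_{i,j}*T_{j,k})_{i,k}$; for $u\in\mathcal S'(\mathbb R^n;\mathbb C^m)$, $S*u=(\sum_jS_{i,j}*u_j)_i$. An i.d.c.s. (infinitely differentiable convolution semigroup) is an infinitely differentiable mapping $[0,\infty)\ni t\mapsto S_t\in\mathcal O'_C(\mathbb R^n;M_{m\times m})$ (right derivatives at $0$) such that $S_{s+t}=S_s*S_t$ for all $s,t\ge0$ and $S_0=\mathbb 1_{m\times m}\otimes\delta$. Its generating distribution is $\frac{d}{dt}\big|_{t=0}S_t$. Under the displayed supremum condition on $\mathcal G$ there is exactly one i.d.c.s. with generating distribution $\mathcal G(\partial_1,\ldots,\partial_n)\otimes\delta$. The operator $\mathcal G_E$ from $E$ into $E$ is defined by $D(\mathcal G_E)=\{u\in E:\mathcal G(\partial_1,\ldots,\partial_n)u\in E\}$ and $\mathcal G_Eu=\mathcal G(\partial_1,\ldots,\partial_n)u$ for $u\in D(\mathcal G_E)$. $D(\mathcal G_E^k)$ is the domain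 of its $k$-th power, and $D(\mathcal G_E^\infty)=\bigcap_{k\ge1}D(\mathcal G_E^k)$. *)

theory Defs
  imports "HOL-Analysis.Analysis" "HOL-Library.Poly_Mapping" "HOL-Library.Extended_Nat"
    "HOL-Library.Landau_Symbols"
begin

section \<open>Complex vector spaces\<close>

class scaleC =
  fixes scaleC :: "complex \<Rightarrow> 'a \<Rightarrow> 'a"  (infixr \<open>*\<^sub>C\<close> 75)

class complex_vector = real_vector + scaleC +
  assumes scaleC_add_right: "a *\<^sub>C (x + y) = a *\<^sub>C x + a *\<^sub>C y"
    and scaleC_add_left: "(a + b) *\<^sub>C x = a *\<^sub>C x + b *\<^sub>C x"
    and scaleC_scaleC: "a *\<^sub>C b *\<^sub>C x = (a * b) *\<^sub>C x"
    and scaleC_one: "1 *\<^sub>C x = x"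
    and scaleR_scaleC: "r *\<^sub>R x = complex_of_real r *\<^sub>C x"

instantiation vec :: (complex_vector, finite) complex_vector
begin

definition scaleC_vec :: "complex \<Rightarrow> 'a ^ 'b \<Rightarrow> 'a ^ 'b"
  where "scaleC_vec c v = (\<chi> i. c *\<^sub>C (v $ i))"

instance
  by standard
    (auto simp: scaleC_vec_def vec_eq_iff scaleC_add_right scaleC_add_left scaleC_scaleC
      scaleC_one scaleR_scaleC)

end

definition complex_subspace :: "'a::complex_vector set \<Rightarrow> bool"
  where "complex_subspace V \<longleftrightarrow>
    0 \<in> V \<and> (\<forall>x\<in>V. \<forall>y\<in>V. x + y \<in> V) \<and> (\<forall>c. \<forall>x\<in>V. c *\<^sub>C x \<in> V)"


section \<open>Topologies on vector spaces\<close>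

definition seminorm_topology :: "('a::ab_group_add \<Rightarrow> real) set \<Rightarrow> 'a topology"
  where "seminorm_topology P =
    topology_generated_by {{y. p (y - x) < e} | p x e. p \<in> P \<and> 0 < e}"

lemma topspace_seminorm_topology [simp]:
  assumes "P \<noteq> {}"
  shows "topspace (seminorm_topology P) = UNIV"
proof -
  obtain p where p: "p \<in> P"
    using assms by blast
  have "y \<in> \<Union>{{y. p (y - x) < e} | p x e. p \<in> P \<and> 0 < e}" for y
    by (rule UnionI[of "{z. p (z - y) < \<bar>p 0\<bar> + 1}"])
      (use p in \<open>auto intro!: exI[of _ p] exI[of _ y] exI[of _ "\<bar>p 0\<bar> + 1"]\<close>)
  then show ?thesis
    unfolding seminorm_topology_def topology_generated_by_topspace by blast
qed

lemma openin_seminorm_ball: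
  "p \<in> P \<Longrightarrow> 0 < e \<Longrightarrow> openin (seminorm_topology P) {y. p (y - x) < e}"
  unfolding seminorm_topology_def by (rule topology_generated_by_Basis) blast

lemma continuous_map_into_seminorm_topology:
  assumes "P \<noteq> {}"
    and triangle: "\<And>p x y. p \<in> P \<Longrightarrow> p (x + y) \<le> p x + p y"
    and near: "\<And>p x e. p \<in> P \<Longrightarrow> x \<in> topspace X \<Longrightarrow> 0 < e \<Longrightarrow>
      \<exists>V. openin X V \<and> x \<in> V \<and> (\<forall>y\<in>V. p (f y - f x) < e)"
  shows "continuous_map X (seminorm_topology P) f"
  unfolding seminorm_topology_def
proof (rule continuous_on_generated_topo)
  fix U
  assume "U \<in> {{y. p (y - x) < e} | p x e. p \<in> P \<and> 0 < e}"
  then obtain p z e where p: "p \<in> P" and U: "U = {y. p (y - z) < e}"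
    by blast
  show "openin X (f -` U \<inter> topspace X)"
  proof (subst openin_subopen, intro ballI)
    fix x
    assume x: "x \<in> f -` U \<inter> topspace X"
    then have "0 < e - p (f x - z)"
      by (simp add: U)
    then obtain V where V: "openin X V" "x \<in> V" "\<And>y. y \<in> V \<Longrightarrow> p (f y - f x) < e - p (f x - z)"
      using near[OF p, of x "e - p (f x - z)"] x by blast
    have "p (f y - z) < e" if "y \<in> V" for y
      using V(3)[OF that] triangle[OF p, of "f y - f x" "f x - z"] by simp
    then show "\<exists>T. openin X T \<and> x \<in> T \<and> T \<subseteq> f -` U \<inter> topspace X"
      using V openin_subset[OF V(1)] by (intro exI[of _ V]) (auto simp: U)
  qed
next
  show "f ` topspace X \<subseteq> \<Union>{{y. p (y - x) < e} | p x e. p \<in> P \<and> 0 < e}"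
    using topspace_seminorm_topology[OF assms(1)]
    unfolding seminorm_topology_def topology_generated_by_topspace by blast
qed

definition vec_topology :: "'a topology \<Rightarrow> ('a ^ 'm) topology"
  where "vec_topology X = pullback_topology UNIV vec_nth (product_topology (\<lambda>_. X) UNIV)"

text \<open>The carrier of the space is \<^term>\<open>topspace X\<close>, a subspace of the ambient type.\<close>

definition locally_convex_space :: "'a::complex_vector topology \<Rightarrow> bool"
  where "locally_convex_space X \<longleftrightarrow>
    complex_subspace (topspace X) \<and>
    continuous_map (prod_topology X X) X (\<lambda>(x, y). x + y) \<and>
    continuous_map (prod_topology euclidean X) X (\<lambda>(c, x). c *\<^sub>C x) \<and>
    (\<forall>U. openin X U \<and> 0 \<in> U \<longrightarrow> (\<exists>V. openin X V \<and> convex V \<and> 0 \<in> V \<and> V \<subseteq> U))"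

definition sequentially_complete :: "'a::complex_vector topology \<Rightarrow> bool"
  where "sequentially_complete X \<longleftrightarrow>
    (\<forall>x :: nat \<Rightarrow> 'a.
      range x \<subseteq> topspace X \<and>
      (\<forall>U. openin X U \<and> 0 \<in> U \<longrightarrow> (\<exists>N. \<forall>i\<ge>N. \<forall>j\<ge>N. x i - x j \<in> U)) \<longrightarrow>
      (\<exists>l. limitin X x l sequentially))"

definition has_derivative_in ::
    "'a::real_vector topology \<Rightarrow> (real \<Rightarrow> 'a) \<Rightarrow> 'a \<Rightarrow> real \<Rightarrow> bool"
  where "has_derivative_in X u d t \<longleftrightarrow>
    limitin X (\<lambda>s. (1 / (s - t)) *\<^sub>R (u s - u t)) d (at t within {0..})"

text \<open>
  Membership in \<open>C\<^sup>k([0,\<infinity>); X)\<close>, with \<open>d j\<close> the derivative of order \<open>j\<close> and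
  \<open>k = \<infinity>\<close> allowed.
\<close>

definition C_k_in :: "'a::real_vector topology \<Rightarrow> enat \<Rightarrow> (real \<Rightarrow> 'a) \<Rightarrow> bool"
  where "C_k_in X k u \<longleftrightarrow>
    (\<exists>d :: nat \<Rightarrow> real \<Rightarrow> 'a.
      (\<forall>t\<ge>0. d 0 t = u t) \<and>
      (\<forall>j. enat j \<le> k \<longrightarrow> continuous_map (top_of_set {0..}) X (d j)) \<and>
      (\<forall>j. enat j < k \<longrightarrow> (\<forall>t\<ge>0. has_derivative_in X (d j) (d (Suc j) t) t)))"


section \<open>The Schwartz space\<close>

definition partial :: "'n::finite \<Rightarrow> (real ^ 'n \<Rightarrow> complex) \<Rightarrow> real ^ 'n \<Rightarrow> complex"
  where "partial k f x = vector_derivative (\<lambda>s. f (x + s *\<^sub>R axis k 1)) (at 0)"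

definition partials :: "'n::finite list \<Rightarrow> (real ^ 'n \<Rightarrow> complex) \<Rightarrow> real ^ 'n \<Rightarrow> complex"
  where "partials ks f = foldr partial ks f"

definition smooth :: "(real ^ 'n::finite \<Rightarrow> complex) \<Rightarrow> bool"
  where "smooth f \<longleftrightarrow> (\<forall>ks x. partials ks f differentiable at x)"

definition rapidly_decreasing :: "(real ^ 'n::finite \<Rightarrow> complex) \<Rightarrow> bool"
  where "rapidly_decreasing f \<longleftrightarrow>
    (\<forall>N ks. \<exists>C. \<forall>x. (1 + norm x) ^ N * cmod (partials ks f x) \<le> C)"

lemma partials_Nil [simp]: "partials [] f = f"
  and partials_Cons: "partials (k # ks) f = partial k (partials ks f)"
  and partials_append: "partials (ks @ ls) f = partials ks (partials ls f)"
  by (simp_all add: partials_def)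

lemma smooth_partials: "smooth f \<Longrightarrow> smooth (partials ks f)"
  by (simp add: smooth_def flip: partials_append)

lemma partial_has_vector_derivative:
  assumes "f differentiable at x"
  shows "((\<lambda>s. f (x + s *\<^sub>R axis k 1)) has_vector_derivative partial k f x) (at 0)"
proof -
  have "(\<lambda>s. f (x + s *\<^sub>R axis k 1)) differentiable at (0::real)"
    using differentiable_chain_at[of "\<lambda>s. x + s *\<^sub>R axis k 1" 0 f] assms
    by (simp add: o_def)
  then show ?thesis
    unfolding partial_def by (simp add: vector_derivative_works)
qed

lemma partial_eqI:
  assumes "((\<lambda>s. f (x + s *\<^sub>R axis k 1)) has_vector_derivative d) (at 0)"
  shows "partial k f x = d"
  unfolding partial_def using assms by (rule vector_derivative_at)

lemma partials_add:
  assumes "smooth f" "smooth g"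
  shows "partials ks (\<lambda>x. f x + g x) = (\<lambda>x. partials ks f x + partials ks g x)"
proof (induction ks)
  case (Cons k ks)
  have "partial k (\<lambda>x. partials ks f x + partials ks g x) x
      = partial k (partials ks f) x + partial k (partials ks g) x" for x
    using assms
    by (intro partial_eqI has_vector_derivative_add partial_has_vector_derivative)
      (auto simp: smooth_def)
  then show ?case
    by (simp add: partials_Cons Cons.IH fun_eq_iff)
qed simp

lemma partials_cmult:
  assumes "smooth f"
  shows "partials ks (\<lambda>x. c * f x) = (\<lambda>x. c * partials ks f x)"
proof (induction ks)
  case (Cons k ks)
  have "partial k (\<lambda>x. c * partials ks f x) x = c * partial k (partials ks f) x" for x
    using assms
    by (intro partial_eqI has_vector_derivative_mult_right partial_has_vector_derivative)
      (auto simp: smooth_def)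
  then show ?case
    by (simp add: partials_Cons Cons.IH fun_eq_iff)
qed simp

lemma partials_zero: "partials ks (\<lambda>x. 0) = (\<lambda>x. 0)"
  by (induction ks) (auto simp: partials_Cons partial_def fun_eq_iff)

lemma partials_translate: "partials ks (\<lambda>x. f (h + x)) = (\<lambda>x. partials ks f (h + x))"
  by (induction ks) (auto simp: partials_Cons partial_def fun_eq_iff add.assoc)

lemma partials_reflect:
  assumes "smooth f"
  shows "partials ks (\<lambda>x. f (- x)) = (\<lambda>x. (- 1) ^ length ks * partials ks f (- x))"
proof (induction ks)
  case (Cons k ks)
  have "partial k (\<lambda>x. (- 1) ^ length ks * partials ks f (- x)) x
      = (- 1) ^ length ks * - partial k (partials ks f) (- x)" for x
  proof (intro partial_eqI has_vector_derivative_mult_right)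
    have *: "((\<lambda>s. partials ks f (- x + s *\<^sub>R axis k 1)) has_vector_derivative
        partial k (partials ks f) (- x)) (at (- 0))"
      using assms partial_has_vector_derivative[of "partials ks f" "- x" k]
      by (auto simp: smooth_def)
    have "((\<lambda>s::real. - s) has_vector_derivative - 1) (at 0)"
      by (auto intro!: derivative_eq_intros)
    from vector_diff_chain_at[OF this *]
    show "((\<lambda>s. partials ks f (- (x + s *\<^sub>R axis k 1))) has_vector_derivative
        - partial k (partials ks f) (- x)) (at 0)"
      by (simp add: o_def minus_diff_commute)
  qed
  then show ?case
    by (simp add: partials_Cons Cons.IH fun_eq_iff)
qed simp

lemma rapidly_decreasingI:
  assumes "\<And>N ks. \<exists>C. \<forall>x. (1 + norm x) ^ N * cmod (partials ks f x) \<le> C"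
  shows "rapidly_decreasing f"
  using assms by (simp add: rapidly_decreasing_def)

typedef (overloaded) ('n::finite) schwartz =
    "{f :: real ^ 'n \<Rightarrow> complex. smooth f \<and> rapidly_decreasing f}"
  morphisms schwartz_fun Schwartz
  by (rule exI[of _ "\<lambda>_. 0"]) (auto simp: smooth_def rapidly_decreasing_def partials_zero)

setup_lifting type_definition_schwartz

instantiation schwartz :: (finite) complex_vector
begin

lift_definition zero_schwartz :: "'a schwartz" is "\<lambda>x. 0"
  by (auto simp: smooth_def rapidly_decreasing_def partials_zero)

lift_definition plus_schwartz :: "'a schwartz \<Rightarrow> 'a schwartz \<Rightarrow> 'a schwartz"
  is "\<lambda>f g x. f x + g x"
proof (intro conjI rapidly_decreasingI, elim conjE)
  fix f g :: "real ^ 'a \<Rightarrow> complex"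
  assume "smooth f" "smooth g"
  then show "smooth (\<lambda>x. f x + g x)"
    by (auto simp: smooth_def[of "\<lambda>x. f x + g x"] partials_add) (auto simp: smooth_def)
next
  fix f g :: "real ^ 'a \<Rightarrow> complex" and N ks
  assume *: "smooth f \<and> rapidly_decreasing f" "smooth g \<and> rapidly_decreasing g"
  obtain A B where A: "\<And>x. (1 + norm x) ^ N * cmod (partials ks f x) \<le> A"
    and B: "\<And>x. (1 + norm x) ^ N * cmod (partials ks g x) \<le> B"
    using * unfolding rapidly_decreasing_def by blast
  have "(1 + norm x) ^ N * cmod (partials ks f x + partials ks g x) \<le> A + B" for x
  proof -
    have "(1 + norm x) ^ N * cmod (partials ks f x + partials ks g x)
        \<le> (1 + norm x) ^ N * (cmod (partials ks f x) + cmod (partials ks g x))"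
      by (intro mult_left_mono norm_triangle_ineq) auto
    also have "\<dots> \<le> A + B"
      using A[of x] B[of x] by (simp add: distrib_left)
    finally show ?thesis .
  qed
  then show "\<exists>C. \<forall>x. (1 + norm x) ^ N * cmod (partials ks (\<lambda>x. f x + g x) x) \<le> C"
    using * by (auto simp: partials_add)
qed

lift_definition scaleC_schwartz :: "complex \<Rightarrow> 'a schwartz \<Rightarrow> 'a schwartz"
  is "\<lambda>c f x. c * f x"
proof (intro conjI rapidly_decreasingI, elim conjE)
  fix f :: "real ^ 'a \<Rightarrow> complex" and c
  assume "smooth f"
  then show "smooth (\<lambda>x. c * f x)"
    by (auto simp: smooth_def[of "\<lambda>x. c * f x"] partials_cmult) (auto simp: smooth_def)
next
  fix f :: "real ^ 'a \<Rightarrow> complex" and c N ks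
  assume *: "smooth f \<and> rapidly_decreasing f"
  obtain A where A: "\<And>x. (1 + norm x) ^ N * cmod (partials ks f x) \<le> A"
    using * unfolding rapidly_decreasing_def by blast
  have "(1 + norm x) ^ N * cmod (c * partials ks f x) \<le> cmod c * A" for x
    using mult_left_mono[OF A[of x], of "cmod c"] by (simp add: norm_mult algebra_simps)
  then show "\<exists>C. \<forall>x. (1 + norm x) ^ N * cmod (partials ks (\<lambda>x. c * f x) x) \<le> C"
    using * by (auto simp: partials_cmult)
qed

definition scaleR_schwartz :: "real \<Rightarrow> 'a schwartz \<Rightarrow> 'a schwartz"
  where "scaleR_schwartz r f = complex_of_real r *\<^sub>C f"

definition uminus_schwartz :: "'a schwartz \<Rightarrow> 'a schwartz"
  where "uminus_schwartz f = (- 1) *\<^sub>C f"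

definition minus_schwartz :: "'a schwartz \<Rightarrow> 'a schwartz \<Rightarrow> 'a schwartz"
  where "minus_schwartz f g = f + - g"

instance
proof
  fix a b c :: "'a schwartz"
  show "a + b + c = a + (b + c)"
    by transfer (simp add: add.assoc)
  show "a + b = b + a"
    by transfer (simp add: add.commute)
  show "0 + a = a"
    by transfer simp
  show "- a + a = 0"
    unfolding uminus_schwartz_def by transfer simp
  show "a - b = a + - b"
    by (rule minus_schwartz_def)
next
  fix r s :: real and a b :: "'a schwartz"
  show "r *\<^sub>R (a + b) = r *\<^sub>R a + r *\<^sub>R b"
    unfolding scaleR_schwartz_def by transfer (simp add: distrib_left)
  show "(r + s) *\<^sub>R a = r *\<^sub>R a + s *\<^sub>R a"
    unfolding scaleR_schwartz_def by transfer (simp add: distrib_right)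
  show "r *\<^sub>R s *\<^sub>R a = (r * s) *\<^sub>R a"
    unfolding scaleR_schwartz_def by transfer (simp add: mult.assoc)
  show "1 *\<^sub>R a = a"
    unfolding scaleR_schwartz_def by transfer simp
next
  fix r s :: complex and a b :: "'a schwartz"
  show "r *\<^sub>C (a + b) = r *\<^sub>C a + r *\<^sub>C b"
    by transfer (simp add: distrib_left)
  show "(r + s) *\<^sub>C a = r *\<^sub>C a + s *\<^sub>C a"
    by transfer (simp add: distrib_right)
  show "r *\<^sub>C s *\<^sub>C a = (r * s) *\<^sub>C a"
    by transfer (simp add: mult.assoc)
  show "1 *\<^sub>C a = a"
    by transfer simp
next
  fix r and a :: "'a schwartz"
  show "r *\<^sub>R a = complex_of_real r *\<^sub>C a"
    by (rule scaleR_schwartz_def)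
qed

end

lift_definition schwartz_partial :: "'n::finite \<Rightarrow> 'n schwartz \<Rightarrow> 'n schwartz" is partial
proof
  fix k and f :: "real ^ 'n \<Rightarrow> complex"
  assume *: "smooth f \<and> rapidly_decreasing f"
  then show "smooth (partial k f)"
    using smooth_partials[of f "[k]"] by (simp add: partials_Cons)
  show "rapidly_decreasing (partial k f)"
  proof (rule rapidly_decreasingI)
    fix N ks
    have "partials ks (partial k f) = partials (ks @ [k]) f"
      by (simp add: partials_append partials_Cons)
    then show "\<exists>C. \<forall>x. (1 + norm x) ^ N * cmod (partials ks (partial k f) x) \<le> C"
      using * unfolding rapidly_decreasing_def by simp
  qed
qed

lift_definition translate :: "real ^ 'n \<Rightarrow> 'n::finite schwartz \<Rightarrow> 'n schwartz"
  is "\<lambda>h f x. f (h + x)"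
proof (intro conjI rapidly_decreasingI, elim conjE)
  fix h :: "real ^ 'n" and f :: "real ^ 'n \<Rightarrow> complex"
  assume f: "smooth f"
  show "smooth (\<lambda>x. f (h + x))"
    unfolding smooth_def partials_translate
  proof (intro allI)
    fix ks x
    show "(\<lambda>x. partials ks f (h + x)) differentiable at x"
      using f differentiable_chain_at[of "\<lambda>x. h + x" x "partials ks f"]
      by (simp add: o_def smooth_def)
  qed
next
  fix h :: "real ^ 'n" and f :: "real ^ 'n \<Rightarrow> complex" and N ks
  assume "smooth f \<and> rapidly_decreasing f"
  then obtain A where A: "\<And>x. (1 + norm x) ^ N * cmod (partials ks f x) \<le> A"
    unfolding rapidly_decreasing_def by blast
  have "(1 + norm x) ^ N * cmod (partials ks f (h + x)) \<le> (1 + norm h) ^ N * A" for x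
  proof -
    have "norm x \<le> norm h + norm (h + x)"
      using norm_triangle_ineq4[of "h + x" h] by simp
    moreover have "0 \<le> norm h * norm (h + x)"
      by simp
    ultimately have "1 + norm x \<le> (1 + norm h) * (1 + norm (h + x))"
      unfolding distrib_left distrib_right by linarith
    then have "(1 + norm x) ^ N \<le> (1 + norm h) ^ N * (1 + norm (h + x)) ^ N"
      by (metis power_mono power_mult_distrib add_nonneg_nonneg norm_ge_zero zero_le_one)
    then have "(1 + norm x) ^ N * cmod (partials ks f (h + x))
        \<le> (1 + norm h) ^ N * ((1 + norm (h + x)) ^ N * cmod (partials ks f (h + x)))"
      by (metis mult.assoc mult_right_mono norm_ge_zero)
    also have "\<dots> \<le> (1 + norm h) ^ N * A"
      using A by (intro mult_left_mono) auto
    finally show ?thesis .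
  qed
  then show "\<exists>C. \<forall>x. (1 + norm x) ^ N * cmod (partials ks (\<lambda>x. f (h + x)) x) \<le> C"
    by (auto simp: partials_translate)
qed

lift_definition reflect :: "'n::finite schwartz \<Rightarrow> 'n schwartz" is "\<lambda>f x. f (- x)"
proof (intro conjI rapidly_decreasingI, elim conjE)
  fix f :: "real ^ 'n \<Rightarrow> complex"
  assume f: "smooth f"
  show "smooth (\<lambda>x. f (- x))"
    unfolding smooth_def partials_reflect[OF f]
  proof (intro allI differentiable_mult)
    fix ks x
    show "(\<lambda>x. partials ks f (- x)) differentiable at x"
      using f differentiable_chain_at[of "\<lambda>x. - x" x "partials ks f"]
      by (simp add: o_def smooth_def)
  qed auto
next
  fix f :: "real ^ 'n \<Rightarrow> complex" and N ks
  assume *: "smooth f \<and> rapidly_decreasing f"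
  then obtain A where "\<And>x. (1 + norm x) ^ N * cmod (partials ks f x) \<le> A"
    unfolding rapidly_decreasing_def by blast
  from this[of "- x" for x]
  show "\<exists>C. \<forall>x. (1 + norm x) ^ N * cmod (partials ks (\<lambda>x. f (- x)) x) \<le> C"
    using * by (auto simp: partials_reflect norm_mult norm_power)
qed

definition schwartz_seminorm :: "nat \<Rightarrow> 'n::finite list \<Rightarrow> 'n schwartz \<Rightarrow> real"
  where "schwartz_seminorm N ks \<phi> =
    (SUP x. (1 + norm x) ^ N * cmod (partials ks (schwartz_fun \<phi>) x))"

definition schwartz_topology :: "'n::finite schwartz topology"
  where "schwartz_topology = seminorm_topology {schwartz_seminorm N ks | N ks. True}"

definition schwartz_bounded :: "'n::finite schwartz set \<Rightarrow> bool"
  where "schwartz_bounded B \<longleftrightarrow> (\<forall>N ks. bdd_above (schwartz_seminorm N ks ` B))"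

definition schwartz_operators :: "('n::finite schwartz \<Rightarrow> 'n schwartz) set"
  where "schwartz_operators = {A.
    (\<forall>\<phi> \<psi>. A (\<phi> + \<psi>) = A \<phi> + A \<psi>) \<and> (\<forall>c \<phi>. A (c *\<^sub>C \<phi>) = c *\<^sub>C A \<phi>) \<and>
    continuous_map schwartz_topology schwartz_topology A}"

definition compact_open_topology :: "('n::finite schwartz \<Rightarrow> 'n schwartz) topology"
  where "compact_open_topology = topology_generated_by
    {{A \<in> schwartz_operators. A ` K \<subseteq> U} | K U.
      compactin schwartz_topology K \<and> openin schwartz_topology U}"

lemma schwartz_seminorm_upper:
  "(1 + norm x) ^ N * cmod (partials ks (schwartz_fun \<phi>) x) \<le> schwartz_seminorm N ks \<phi>"
proof -
  have "bdd_above (range (\<lambda>x. (1 + norm x) ^ N * cmod (partials ks (schwartz_fun \<phi>) x)))"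
    using schwartz_fun[of \<phi>] unfolding rapidly_decreasing_def bdd_above_def by blast
  then show ?thesis
    unfolding schwartz_seminorm_def by (rule cSUP_upper[OF UNIV_I])
qed

lemma schwartz_seminorm_triangle:
  "schwartz_seminorm N ks (\<phi> + \<psi>) \<le> schwartz_seminorm N ks \<phi> + schwartz_seminorm N ks \<psi>"
  unfolding schwartz_seminorm_def[of N ks "\<phi> + \<psi>"]
proof (rule cSUP_least)
  fix x
  have "partials ks (schwartz_fun (\<phi> + \<psi>)) x
      = partials ks (schwartz_fun \<phi>) x + partials ks (schwartz_fun \<psi>) x"
    using schwartz_fun[of \<phi>] schwartz_fun[of \<psi>] by (simp add: plus_schwartz.rep_eq partials_add)
  then have "(1 + norm x) ^ N * cmod (partials ks (schwartz_fun (\<phi> + \<psi>)) x)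
      \<le> (1 + norm x) ^ N *
        (cmod (partials ks (schwartz_fun \<phi>) x) + cmod (partials ks (schwartz_fun \<psi>) x))"
    by (simp add: mult_left_mono norm_triangle_ineq)
  also have "\<dots> \<le> schwartz_seminorm N ks \<phi> + schwartz_seminorm N ks \<psi>"
    using schwartz_seminorm_upper[of x N ks \<phi>] schwartz_seminorm_upper[of x N ks \<psi>]
    by (simp add: distrib_left)
  finally show "(1 + norm x) ^ N * cmod (partials ks (schwartz_fun (\<phi> + \<psi>)) x)
      \<le> schwartz_seminorm N ks \<phi> + schwartz_seminorm N ks \<psi>" .
qed simp

lemma schwartz_seminorm_zero [simp]: "schwartz_seminorm N ks 0 = 0"
  by (simp add: schwartz_seminorm_def zero_schwartz.rep_eq partials_zero)

lemma schwartz_seminorm_partial: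
  "schwartz_seminorm N ks (schwartz_partial k \<phi>) = schwartz_seminorm N (ks @ [k]) \<phi>"
  by (simp add: schwartz_seminorm_def schwartz_partial.rep_eq partials_append partials_Cons)

lemma schwartz_partial_add:
  "schwartz_partial k (\<phi> + \<psi>) = schwartz_partial k \<phi> + schwartz_partial k \<psi>"
proof (transfer, elim conjE)
  fix k :: 'a and f g :: "real ^ 'a \<Rightarrow> complex"
  assume "smooth f" "smooth g"
  from partials_add[OF this, of "[k]"]
  show "partial k (\<lambda>x. f x + g x) = (\<lambda>x. partial k f x + partial k g x)"
    by (simp add: partials_Cons)
qed

lemma schwartz_partial_scaleC: "schwartz_partial k (c *\<^sub>C \<phi>) = c *\<^sub>C schwartz_partial k \<phi>"
proof (transfer, elim conjE)
  fix k :: 'a and c and f :: "real ^ 'a \<Rightarrow> complex"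
  assume "smooth f"
  from partials_cmult[OF this, of "[k]" c]
  show "partial k (\<lambda>x. c * f x) = (\<lambda>x. c * partial k f x)"
    by (simp add: partials_Cons)
qed

lemma schwartz_partial_diff:
  "schwartz_partial k (\<phi> - \<psi>) = schwartz_partial k \<phi> - schwartz_partial k \<psi>"
  using schwartz_partial_add[of k "\<phi> - \<psi>" \<psi>] by (simp only: diff_add_cancel eq_diff_eq)

lemma topspace_schwartz [simp]: "topspace schwartz_topology = UNIV"
  unfolding schwartz_topology_def by (rule topspace_seminorm_topology) auto

lemma openin_schwartz_ball:
  "0 < e \<Longrightarrow> openin schwartz_topology {\<psi>. schwartz_seminorm N ks (\<psi> - \<phi>) < e}"
  unfolding schwartz_topology_def by (rule openin_seminorm_ball) auto

lemma continuous_map_schwartz_partial: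
  "continuous_map schwartz_topology schwartz_topology (schwartz_partial k)"
proof -
  have "continuous_map schwartz_topology
      (seminorm_topology {schwartz_seminorm N ks | N (ks :: 'a list). True}) (schwartz_partial k)"
  proof (rule continuous_map_into_seminorm_topology)
    fix p :: "'a schwartz \<Rightarrow> real" and \<phi> and e :: real
    assume "p \<in> {schwartz_seminorm N ks |N ks. True}" and e: "0 < e"
    then obtain N ks where p: "p = schwartz_seminorm N ks"
      by blast
    show "\<exists>V. openin schwartz_topology V \<and> \<phi> \<in> V \<and>
        (\<forall>\<psi>\<in>V. p (schwartz_partial k \<psi> - schwartz_partial k \<phi>) < e)"
      using openin_schwartz_ball[OF e, of N "ks @ [k]" \<phi>] e
      by (intro exI[of _ "{\<psi>. schwartz_seminorm N (ks @ [k]) (\<psi> - \<phi>) < e}"])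
        (auto simp: p schwartz_seminorm_partial simp flip: schwartz_partial_diff)
  qed (use schwartz_seminorm_triangle in auto)
  then show ?thesis
    unfolding schwartz_topology_def[symmetric] .
qed


section \<open>Polynomials and multi-indices\<close>

type_synonym 'n multi_index = "'n \<Rightarrow>\<^sub>0 nat"

type_synonym 'n polynomial = "'n multi_index \<Rightarrow>\<^sub>0 complex"

definition mi_order :: "'n::finite multi_index \<Rightarrow> nat"
  where "mi_order \<alpha> = (\<Sum>k\<in>UNIV. Poly_Mapping.lookup \<alpha> k)"

definition coordinates :: "'n::finite list"
  where "coordinates = (SOME ks. distinct ks \<and> set ks = UNIV)"

text \<open>
  The monomial \<open>D\<^sup>\<alpha>\<close> in a family of operators. It is only used for partial derivatives, which
  commute, so the enumeration of the coordinates is immaterial.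
\<close>

definition mi_power :: "('n::finite \<Rightarrow> 'a \<Rightarrow> 'a) \<Rightarrow> 'n multi_index \<Rightarrow> 'a \<Rightarrow> 'a"
  where "mi_power D \<alpha> = foldr (\<lambda>k. D k ^^ Poly_Mapping.lookup \<alpha> k) coordinates"

definition eval_poly :: "'n::finite polynomial \<Rightarrow> complex ^ 'n \<Rightarrow> complex"
  where "eval_poly p \<zeta> =
    (\<Sum>\<alpha>\<in>Poly_Mapping.keys p. Poly_Mapping.lookup p \<alpha> *
      (\<Prod>k\<in>UNIV. (\<zeta> $ k) ^ Poly_Mapping.lookup \<alpha> k))"

definition matrix_spectrum :: "complex ^ 'm ^ 'm::finite \<Rightarrow> complex set"
  where "matrix_spectrum B = {z. \<not> invertible (mat z - B)}"

definition symbol :: "'n::finite polynomial ^ 'm ^ 'm \<Rightarrow> real ^ 'n \<Rightarrow> complex ^ 'm ^ 'm"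
  where "symbol G \<xi> = (\<chi> j k. eval_poly (G $ j $ k) (\<chi> l. \<i> * complex_of_real (\<xi> $ l)))"


section \<open>Tempered distributions\<close>

typedef (overloaded) ('n::finite) tempered =
    "{T :: 'n schwartz \<Rightarrow> complex.
      (\<forall>\<phi> \<psi>. T (\<phi> + \<psi>) = T \<phi> + T \<psi>) \<and> (\<forall>c \<phi>. T (c *\<^sub>C \<phi>) = c * T \<phi>) \<and>
      continuous_map schwartz_topology euclidean T}"
  morphisms apply_dist Tempered
  by (rule exI[of _ "\<lambda>_. 0"]) auto

setup_lifting type_definition_tempered

instantiation tempered :: (finite) complex_vector
begin

lift_definition zero_tempered :: "'a tempered" is "\<lambda>\<phi>. 0"
  by auto

lift_definition plus_tempered :: "'a tempered \<Rightarrow> 'a tempered \<Rightarrow> 'a tempered"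
  is "\<lambda>S T \<phi>. S \<phi> + T \<phi>"
  by (auto simp: algebra_simps intro: continuous_map_add)

lift_definition scaleC_tempered :: "complex \<Rightarrow> 'a tempered \<Rightarrow> 'a tempered"
  is "\<lambda>c T \<phi>. c * T \<phi>"
proof (elim conjE, intro conjI)
  fix c :: complex and T :: "'a schwartz \<Rightarrow> complex"
  assume "continuous_map schwartz_topology euclidean T"
  moreover have "continuous_map euclidean euclidean (\<lambda>z :: complex. c * z)"
    by (simp add: continuous_on_mult_left)
  ultimately show "continuous_map schwartz_topology euclidean (\<lambda>\<phi>. c * T \<phi>)"
    using continuous_map_compose[of schwartz_topology euclidean T euclidean "\<lambda>z. c * z"]
    by (simp add: o_def)
qed (simp_all add: algebra_simps)

definition scaleR_tempered :: "real \<Rightarrow> 'a tempered \<Rightarrow> 'a tempered"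
  where "scaleR_tempered r T = complex_of_real r *\<^sub>C T"

definition uminus_tempered :: "'a tempered \<Rightarrow> 'a tempered"
  where "uminus_tempered T = (- 1) *\<^sub>C T"

definition minus_tempered :: "'a tempered \<Rightarrow> 'a tempered \<Rightarrow> 'a tempered"
  where "minus_tempered S T = S + - T"

instance
proof
  fix a b c :: "'a tempered"
  show "a + b + c = a + (b + c)"
    by transfer (simp add: add.assoc)
  show "a + b = b + a"
    by transfer (simp add: add.commute)
  show "0 + a = a"
    by transfer simp
  show "- a + a = 0"
    unfolding uminus_tempered_def by transfer simp
  show "a - b = a + - b"
    by (rule minus_tempered_def)
next
  fix r s :: real and a b :: "'a tempered"
  show "r *\<^sub>R (a + b) = r *\<^sub>R a + r *\<^sub>R b"
    unfolding scaleR_tempered_def by transfer (simp add: distrib_left)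
  show "(r + s) *\<^sub>R a = r *\<^sub>R a + s *\<^sub>R a"
    unfolding scaleR_tempered_def by transfer (simp add: distrib_right)
  show "r *\<^sub>R s *\<^sub>R a = (r * s) *\<^sub>R a"
    unfolding scaleR_tempered_def by transfer (simp add: mult.assoc)
  show "1 *\<^sub>R a = a"
    unfolding scaleR_tempered_def by transfer simp
next
  fix r s :: complex and a b :: "'a tempered"
  show "r *\<^sub>C (a + b) = r *\<^sub>C a + r *\<^sub>C b"
    by transfer (simp add: distrib_left)
  show "(r + s) *\<^sub>C a = r *\<^sub>C a + s *\<^sub>C a"
    by transfer (simp add: distrib_right)
  show "r *\<^sub>C s *\<^sub>C a = (r * s) *\<^sub>C a"
    by transfer (simp add: mult.assoc)
  show "1 *\<^sub>C a = a"
    by transfer simp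
next
  fix r and a :: "'a tempered"
  show "r *\<^sub>R a = complex_of_real r *\<^sub>C a"
    by (rule scaleR_tempered_def)
qed

end

definition strong_seminorm :: "'n::finite schwartz set \<Rightarrow> 'n tempered \<Rightarrow> real"
  where "strong_seminorm B T = (SUP \<phi>\<in>B. cmod (apply_dist T \<phi>))"

definition strong_dual_topology :: "'n::finite tempered topology"
  where "strong_dual_topology =
    seminorm_topology {strong_seminorm B | B. B \<noteq> {} \<and> schwartz_bounded B}"

lift_definition dirac :: "'n::finite tempered" is "\<lambda>\<phi> :: 'n schwartz. schwartz_fun \<phi> 0"
proof (intro conjI allI)
  have diff: "schwartz_fun \<psi> 0 - schwartz_fun \<phi> 0 = schwartz_fun (\<psi> - \<phi>) 0"
    for \<phi> \<psi> :: "'n schwartz"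
    by (simp add: minus_schwartz_def uminus_schwartz_def plus_schwartz.rep_eq
        scaleC_schwartz.rep_eq)
  show "continuous_map schwartz_topology euclidean (\<lambda>\<phi> :: 'n schwartz. schwartz_fun \<phi> 0)"
    unfolding continuous_map_def
  proof (intro conjI allI impI)
    fix U :: "complex set"
    assume "openin euclidean U"
    then have U: "open U"
      by simp
    show "openin schwartz_topology
        {\<phi> :: 'n schwartz \<in> topspace schwartz_topology. schwartz_fun \<phi> 0 \<in> U}"
    proof (subst openin_subopen, intro ballI)
      fix \<phi> :: "'n schwartz"
      assume "\<phi> \<in> {\<phi> \<in> topspace schwartz_topology. schwartz_fun \<phi> 0 \<in> U}"
      then obtain e where e: "0 < e" "\<And>z. cmod (z - schwartz_fun \<phi> 0) < e \<Longrightarrow> z \<in> U"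
        using U unfolding open_dist dist_norm by blast
      let ?V = "{\<psi>. schwartz_seminorm 0 [] (\<psi> - \<phi>) < e}"
      have "schwartz_fun \<psi> 0 \<in> U" if "\<psi> \<in> ?V" for \<psi>
        using that schwartz_seminorm_upper[of 0 0 "[]" "\<psi> - \<phi>"] by (intro e(2)) (simp add: diff)
      then show "\<exists>V. openin schwartz_topology V \<and> \<phi> \<in> V \<and>
          V \<subseteq> {\<phi> \<in> topspace schwartz_topology. schwartz_fun \<phi> 0 \<in> U}"
        using openin_schwartz_ball[OF e(1), of 0 "[]" \<phi>] e(1) by (intro exI[of _ ?V]) auto
    qed
  qed auto
qed (simp_all add: plus_schwartz.rep_eq scaleC_schwartz.rep_eq)

lift_definition tempered_partial :: "'n::finite \<Rightarrow> 'n tempered \<Rightarrow> 'n tempered"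
  is "\<lambda>k T \<phi>. - T (schwartz_partial k \<phi>)"
proof (elim conjE, intro conjI)
  fix k and T :: "'n schwartz \<Rightarrow> complex"
  assume "continuous_map schwartz_topology euclidean T"
  from continuous_map_compose[OF continuous_map_schwartz_partial this]
  have "continuous_map schwartz_topology euclidean (\<lambda>\<phi>. T (schwartz_partial k \<phi>))"
    by (simp add: o_def)
  then show "continuous_map schwartz_topology euclidean (\<lambda>\<phi>. - T (schwartz_partial k \<phi>))"
    by (rule continuous_map_minus)
qed (simp_all add: schwartz_partial_add schwartz_partial_scaleC)

definition diff_op :: "'n::finite polynomial \<Rightarrow> 'n tempered \<Rightarrow> 'n tempered"
  where "diff_op p T =
    (\<Sum>\<alpha>\<in>Poly_Mapping.keys p. Poly_Mapping.lookup p \<alpha> *\<^sub>C mi_power tempered_partial \<alpha> T)"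

definition apply_system ::
    "'n::finite polynomial ^ 'm ^ 'm \<Rightarrow> 'n tempered ^ 'm \<Rightarrow> 'n tempered ^ 'm"
  where "apply_system G u = (\<chi> j. \<Sum>k\<in>UNIV. diff_op (G $ j $ k) (u $ k))"

definition system_dirac :: "'n::finite polynomial ^ 'm ^ 'm \<Rightarrow> 'n tempered ^ 'm ^ 'm"
  where "system_dirac G = (\<chi> j k. diff_op (G $ j $ k) dirac)"

definition identity_dirac :: "'n::finite tempered ^ 'm ^ 'm"
  where "identity_dirac = (\<chi> j k. if j = k then dirac else 0)"


section \<open>Rapidly decreasing distributions and convolution\<close>

text \<open>
  \<open>\<O>'\<^sub>C\<close>: for every \<open>r\<close>, \<open>T\<close> is a finite sum of derivatives \<open>\<partial>\<^sup>\<alpha> f\<^sub>\<alpha>\<close> of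
  continuous functions with \<open>f\<^sub>\<alpha>(x) = O(|x|\<^sup>-\<^sup>r)\<close>; the sum is written out as a functional on
  test functions. Such a distribution is tempered (already by the case \<open>r = 0\<close>), so
  restricting to tempered \<open>T\<close> loses nothing.
\<close>

definition OC :: "'n::finite tempered set"
  where "OC = {T. \<forall>r::nat. \<exists>(m::nat) (f :: 'n multi_index \<Rightarrow> real ^ 'n \<Rightarrow> complex).
    (\<forall>\<alpha>. mi_order \<alpha> \<le> m \<longrightarrow>
      continuous_on UNIV (f \<alpha>) \<and> f \<alpha> \<in> O[at_infinity](\<lambda>x. complex_of_real (1 / norm x ^ r))) \<and>
    (\<forall>\<phi>. apply_dist T \<phi> = (\<Sum>\<alpha> | mi_order \<alpha> \<le> m.
      (- 1) ^ mi_order \<alpha> *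
      (LINT x|lborel. f \<alpha> x * schwartz_fun (mi_power schwartz_partial \<alpha> \<phi>) x)))}"

text \<open>
  \<open>(T * \<phi>)(x) = T(\<phi>(x - \<cdot>))\<close>. For \<open>T \<in> OC\<close> this function of \<open>x\<close> is again in the Schwartz
  space; for other \<open>T\<close> the value is irrelevant.
\<close>

definition conv_test :: "'n::finite tempered \<Rightarrow> 'n schwartz \<Rightarrow> 'n schwartz"
  where "conv_test T \<phi> = Schwartz (\<lambda>x. apply_dist T (reflect (translate x \<phi>)))"

text \<open>
  \<open>(T * u)(\<phi>) = u(T\<^sup>\<or> * \<phi>)\<close>, where \<open>T\<^sup>\<or>\<close> is the reflection of \<open>T\<close> and
  \<open>T\<^sup>\<or> * \<phi> = (T * \<phi>\<^sup>\<or>)\<^sup>\<or>\<close>. For \<open>T \<in> OC\<close> this is a tempered distribution.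
\<close>

definition conv :: "'n::finite tempered \<Rightarrow> 'n tempered \<Rightarrow> 'n tempered"
  where "conv T u = Tempered (\<lambda>\<phi>. apply_dist u (reflect (conv_test T (reflect \<phi>))))"

definition OC_topology :: "'n::finite tempered topology"
  where "OC_topology = pullback_topology OC conv_test compact_open_topology"

abbreviation OC_matrix_topology :: "('n::finite tempered ^ 'm ^ 'm) topology"
  where "OC_matrix_topology \<equiv> vec_topology (vec_topology OC_topology)"

abbreviation tempered_vec_topology :: "('n::finite tempered ^ 'm) topology"
  where "tempered_vec_topology \<equiv> vec_topology strong_dual_topology"

definition conv_matrix ::
    "'n::finite tempered ^ 'm ^ 'm \<Rightarrow> 'n tempered ^ 'm ^ 'm \<Rightarrow> 'n tempered ^ 'm ^ 'm"
  where "conv_matrix S T = (\<chi> i k. \<Sum>j\<in>UNIV. conv (S $ i $ j) (T $ j $ k))"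

definition conv_vec :: "'n::finite tempered ^ 'm ^ 'm \<Rightarrow> 'n tempered ^ 'm \<Rightarrow> 'n tempered ^ 'm"
  where "conv_vec S u = (\<chi> i. \<Sum>j\<in>UNIV. conv (S $ i $ j) (u $ j))"

text \<open>Only the values of \<open>S\<close> on \<open>[0,\<infinity>)\<close> matter.\<close>

definition idcs :: "(real \<Rightarrow> 'n::finite tempered ^ 'm ^ 'm) \<Rightarrow> bool"
  where "idcs S \<longleftrightarrow>
    C_k_in OC_matrix_topology \<infinity> S \<and>
    (\<forall>s\<ge>0. \<forall>t\<ge>0. S (s + t) = conv_matrix (S s) (S t)) \<and>
    S 0 = identity_dirac"

definition generating_distribution ::
    "(real \<Rightarrow> 'n::finite tempered ^ 'm ^ 'm) \<Rightarrow> 'n tempered ^ 'm ^ 'm \<Rightarrow> bool"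
  where "generating_distribution S A \<longleftrightarrow> has_derivative_in OC_matrix_topology S A 0"


section \<open>The operator \<open>\<G>\<^sub>E\<close> and the Cauchy problem\<close>

definition domain_in ::
    "('n::finite tempered ^ 'm) set \<Rightarrow> 'n polynomial ^ 'm ^ 'm \<Rightarrow> ('n tempered ^ 'm) set"
  where "domain_in E G = {u \<in> E. apply_system G u \<in> E}"

primrec domain_power ::
    "('n::finite tempered ^ 'm) set \<Rightarrow> 'n polynomial ^ 'm ^ 'm \<Rightarrow> nat \<Rightarrow> ('n tempered ^ 'm) set"
  where
    "domain_power E G 0 = E"
  | "domain_power E G (Suc k) = {u \<in> domain_in E G. apply_system G u \<in> domain_power E G k}"

definition domain_epower ::
    "('n::finite tempered ^ 'm) set \<Rightarrow> 'n polynomial ^ 'm ^ 'm \<Rightarrow> enat \<Rightarrow> ('n tempered ^ 'm) set"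
  where "domain_epower E G k =
    (case k of enat j \<Rightarrow> domain_power E G j | \<infinity> \<Rightarrow> (\<Inter>j\<in>{1..}. domain_power E G j))"

definition solves_cauchy_in ::
    "('n::finite tempered ^ 'm) topology \<Rightarrow> 'n polynomial ^ 'm ^ 'm \<Rightarrow> 'n tempered ^ 'm \<Rightarrow>
      (real \<Rightarrow> 'n tempered ^ 'm) \<Rightarrow> bool"
  where "solves_cauchy_in X G u\<^sub>0 u \<longleftrightarrow>
    u 0 = u\<^sub>0 \<and> (\<forall>t\<ge>0. has_derivative_in X u (apply_system G (u t)) t)"

end

theory Submission
  imports Defs
begin

text \<open>
  Testing \<open>S\<^sub>t * u\<close> against \<open>\<phi>\<close> gives \<open>u\<close> applied to the adjoint
  convolution operators of the entries of \<open>S\<^sub>t\<close> at \<open>\<phi>\<close>, so differentiability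
  of \<open>S\<close> in \<open>\<O>'\<^sub>C\<close> makes every scalar function
  \<open>t \<mapsto> \<langle>S\<^sub>t * u, \<phi>\<rangle>\<close> differentiable. By the semigroup law its right
  derivative is both \<open>\<langle>\<G>(S\<^sub>t * u), \<phi>\<rangle>\<close> and
  \<open>\<langle>S\<^sub>t * \<G>u, \<phi>\<rangle>\<close>; hence \<open>\<G>\<close> commutes with \<open>S\<^sub>t\<close>.

  Uniqueness: for a solution \<open>v\<close> the function
  \<open>s \<mapsto> \<langle>S\<^bsub>t-s\<^esub> * v(s), \<phi>\<rangle>\<close> has zero derivative on \<open>[0,t]\<close>.
  The product rule needs the strong topology: the difference quotients of \<open>v\<close> converge
  uniformly on the bounded set of the adjoint images of \<open>\<phi>\<close>.

  Existence: for \<open>w\<close> in the domain of \<open>\<G>\<^sub>E\<close> the Riemann sums of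
  \<open>\<tau> \<mapsto> S\<^sub>\<tau> * \<G>w\<close> over \<open>[a,b]\<close> converge in \<open>E\<close>, and the weak
  derivative identifies the limit of their averages as
  \<open>(S\<^sub>b * w - S\<^sub>a * w) / (b - a)\<close>. Being a limit of averages, it is close to
  \<open>S\<^sub>t * \<G>w\<close> when \<open>a\<close> and \<open>b\<close> are close to \<open>t\<close>. The derivative of
  order \<open>j\<close> is therefore \<open>S\<^sub>t * \<G>\<^sup>j u\<^sub>0\<close>.
\<close>

section \<open>Convolution of decaying functions with Schwartz functions\<close>

text \<open>The weight is dominated by a series of multiples of indicators of the balls of radius k
  + 1. The k-th term has integral of order (k + 1)^-2, because the exponent exceeds the dimension by
  2, so the series is integrable.\<close>

lemma integrable_weight:
  "integrable lborel (\<lambda>x::'a::euclidean_space. 1 / (1 + norm x) ^ (DIM('a) + 2))"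
proof (rule Bochner_Integration.integrable_bound)
  let ?p = "DIM('a) + 2"
  define f where "f k x = indicat_real (cball (0::'a) (Suc k)) x * (1 / real (Suc k) ^ ?p)" for k x
  have s2: "summable (\<lambda>k. 1 / real (Suc k) ^ 2)"
    using summable_Suc_iff[of "\<lambda>k. 1 / real k ^ 2"] inverse_power_summable[of 2, where 'a=real]
    by (simp add: inverse_eq_divide)
  have f_nonneg: "0 \<le> f k x" for k x
    by (simp add: f_def)
  have f_le: "f k x \<le> 1 / real (Suc k) ^ 2" for k x
  proof -
    have "real (Suc k) ^ 2 \<le> real (Suc k) ^ ?p"
      by (rule power_increasing) auto
    then show ?thesis
      by (simp add: f_def indicator_def frac_le del: power_Suc)
  qed
  have summ: "summable (\<lambda>k. f k x)" for x
    by (rule summable_comparison_test'[OF s2]) (use f_nonneg f_le in auto)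
  have int: "integrable lborel (f k)" for k
    unfolding f_def by (auto intro!: integrable_mult_left simp: emeasure_cball)
  have intf: "(LINT x|lborel. norm (f k x)) = unit_ball_vol DIM('a) * (1 / real (Suc k) ^ 2)" for k
    unfolding f_def
    by (simp add: content_cball divide_simps power_add power2_eq_square del: of_nat_Suc)
  show "integrable lborel (\<lambda>x. suminf (\<lambda>k. f k x))"
  proof (rule integrable_suminf[OF int])
    show "AE x in lborel. summable (\<lambda>k. norm (f k x))"
      using summ f_nonneg by (auto simp: abs_of_nonneg)
    show "summable (\<lambda>k. LINT x|lborel. norm (f k x))"
      unfolding intf by (intro summable_mult s2)
  qed
  show "AE x in lborel. norm (1 / (1 + norm (x::'a)) ^ ?p) \<le> norm (suminf (\<lambda>k. f k x))"
  proof (rule AE_I2)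
    fix x :: 'a
    \<comment> \<open>The single term of index floor(norm x) already dominates the weight at x: x
      lies in the ball of radius k + 1, and 1 + norm x is at least k + 1.\<close>
    define k where "k = nat \<lfloor>norm x\<rfloor>"
    have k: "real k \<le> norm x" "norm x \<le> Suc k"
      by (auto simp: k_def) linarith+
    have "1 / (1 + norm x) ^ ?p \<le> 1 / real (Suc k) ^ ?p"
      using k by (intro divide_left_mono power_mono mult_pos_pos zero_less_power) (auto simp:
          add_pos_nonneg)
    also have "\<dots> = f k x"
      using k by (simp add: f_def)
    also have "\<dots> = (\<Sum>i\<in>{k}. f i x)" by simp
    also have "\<dots> \<le> (suminf (\<lambda>k. f k x))"
      by (rule sum_le_suminf[OF summ]) (auto simp: f_nonneg)
    finally show "norm (1 / (1 + norm x) ^ ?p) \<le> norm (suminf (\<lambda>k. f k x))"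
      by simp
  qed
qed measurable

text \<open>The Landau bound speaks only about large x. On the remaining compact ball continuity
  supplies a bound, and 1 + norm x replaces norm x so that the estimate makes sense at the
  origin.\<close>

lemma continuous_bigo_bound:
  fixes f :: "real ^ 'n::finite \<Rightarrow> complex"
  assumes cont: "continuous_on UNIV f"
    and f: "f \<in> O[at_infinity](\<lambda>x. complex_of_real (1 / norm x ^ r))"
  obtains C where "0 \<le> C" "\<And>x. cmod (f x) \<le> C / (1 + norm x) ^ r"
proof -
  obtain c where c: "0 < c"
    "eventually (\<lambda>x. norm (f x) \<le> c * norm (complex_of_real (1 / norm x ^ r))) at_infinity"
    using landau_o.bigE[OF f] by blast
  obtain R where R: "\<And>x. R \<le> norm x \<Longrightarrow> norm (f x) \<le> c * norm
      (complex_of_real (1 / norm x ^ r))"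
    using c(2) unfolding eventually_at_infinity by blast
  \<comment> \<open>Radius at least 1 gives 1 + norm x <= 2 * norm x outside the ball, which is
    where the factor 2^r comes from.\<close>
  define R' where "R' = max R 1"
  obtain A where A: "\<And>x. x \<in> cball 0 R' \<Longrightarrow> \<bar>cmod (f x) * (1 + norm x)
      ^ r\<bar> \<le> A"
  proof -
    have "continuous_on (cball 0 R') (\<lambda>x. cmod (f x) * (1 + norm x) ^ r)"
      by (intro continuous_intros continuous_on_subset[OF cont]) auto
    then have "bounded ((\<lambda>x. cmod (f x) * (1 + norm x) ^ r) ` cball 0 R')"
      by (intro compact_imp_bounded compact_continuous_image) auto
    then show ?thesis
      using that by (auto simp only: bounded_iff real_norm_def)
  qed
  have bound: "cmod (f x) \<le> max A (c * 2 ^ r) / (1 + norm x) ^ r" for x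
  proof (cases "norm x \<le> R'")
    case True
    then have "cmod (f x) * (1 + norm x) ^ r \<le> A"
      using A[of x] by simp
    then show ?thesis
      by (simp add: field_simps add_pos_nonneg)
  next
    case False
    then have x: "R \<le> norm x" "1 \<le> norm x"
      by (auto simp: R'_def)
    have "(1 + norm x) ^ r \<le> (2 * norm x) ^ r"
      using x by (intro power_mono) auto
    then have "cmod (f x) * (1 + norm x) ^ r \<le> (c / norm x ^ r) * (2 * norm x) ^ r"
      using R[OF x(1)] c(1) by (intro mult_mono) (auto simp: norm_divide norm_power)
    also have "\<dots> = c * 2 ^ r"
      using x by (auto simp: power_mult_distrib)
    finally have "cmod (f x) * (1 + norm x) ^ r \<le> max A (c * 2 ^ r)"
      by simp
    then show ?thesis
      by (simp add: field_simps add_pos_nonneg)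
  qed
  moreover have "0 \<le> max A (c * 2 ^ r)"
    using c(1) by (simp add: le_max_iff_disj)
  ultimately show ?thesis
    using that by blast
qed

section \<open>Total derivatives and the Taylor expansion of Schwartz functions\<close>

lemma smooth_has_derivative:
  fixes g :: "real ^ 'n::finite \<Rightarrow> complex"
  assumes "g differentiable at x"
  shows "(g has_derivative (\<lambda>h. \<Sum>k\<in>UNIV. of_real (h $ k) * partial k g x)) (at x)"
proof -
  obtain D where D: "(g has_derivative D) (at x)"
    using assms by (auto simp: differentiable_def)
  interpret D: bounded_linear D
    using D by (rule has_derivative_bounded_linear)
  \<comment> \<open>\<open>partial\<close> is defined along coordinate lines; the chain rule
    identifies it with the value of the total derivative on a basis vector, and linearity of
    \<open>D\<close> gives the rest.\<close>
  have "partial k g x = D (axis k 1)" for k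
  proof (rule partial_eqI)
    have "((\<lambda>s::real. x + s *\<^sub>R axis k 1) has_derivative (\<lambda>s. s *\<^sub>R
        axis k 1)) (at 0)"
      by (auto intro!: derivative_eq_intros)
    from has_derivative_compose[OF this, of g D] D
    show "((\<lambda>s. g (x + s *\<^sub>R axis k 1)) has_vector_derivative D (axis k 1)) (at 0)"
      by (simp add: has_vector_derivative_def D.scaleR)
  qed
  then have "D h = (\<Sum>k\<in>UNIV. of_real (h $ k) * partial k g x)" for h
  proof -
    have "D h = D (\<Sum>k\<in>UNIV. (h $ k) *\<^sub>R axis k 1)"
      using basis_expansion[of h] by (simp add: scalar_mult_eq_scaleR)
    also have "\<dots> = (\<Sum>k\<in>UNIV. (h $ k) *\<^sub>R D (axis k 1))"
      by (simp only: D.sum D.scaleR)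
    also have "\<dots> = (\<Sum>k\<in>UNIV. of_real (h $ k) * D (axis k 1))"
      by (simp only: scaleR_conv_of_real)
    finally show ?thesis
      using \<open>\<And>k. partial k g x = D (axis k 1)\<close> by simp
  qed
  then show ?thesis
    using D by (metis (no_types, lifting) ext)
qed

text \<open>Serves to read off the partial derivatives of a convolution from its total derivative,
  obtained in this form in \<open>conv_fun_has_derivative\<close>.\<close>

lemma has_derivative_imp_partial:
  fixes g :: "real ^ 'n::finite \<Rightarrow> complex"
  assumes "(g has_derivative (\<lambda>h. \<Sum>k\<in>UNIV. of_real (h $ k) * d k)) (at x)"
  shows "partial k g x = d k"
proof (rule partial_eqI)
  have "((\<lambda>s::real. x + s *\<^sub>R axis k 1) has_derivative (\<lambda>s. s *\<^sub>R axis
      k 1)) (at 0)"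
    by (auto intro!: derivative_eq_intros)
  from has_derivative_compose[OF this, of g "\<lambda>h. \<Sum>k\<in>UNIV. of_real (h $ k) * d k"] assms
  have "((\<lambda>s. g (x + s *\<^sub>R axis k 1)) has_derivative
      (\<lambda>s. \<Sum>l\<in>UNIV. of_real ((s *\<^sub>R axis k 1) $ l) * d l)) (at 0)"
    by simp
  moreover have "(\<Sum>l\<in>UNIV. of_real ((s *\<^sub>R axis k 1 :: real ^ 'n) $ l) * d l) = s
      *\<^sub>R d k" for s
    by (simp add: axis_def if_distrib if_distribR scaleR_conv_of_real[where 'a=complex] cong: if_cong
        del: of_real_mult)
  ultimately show "((\<lambda>s. g (x + s *\<^sub>R axis k 1)) has_vector_derivative d k) (at 0)"
    by (simp add: has_vector_derivative_def)
qed

lemma rapidly_decreasing_bounded_partials: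
  assumes "rapidly_decreasing g"
  obtains C where "0 \<le> C" "\<And>x. cmod (partials ks g x) \<le> C"
proof -
  obtain C where C: "\<And>x. (1 + norm x) ^ 0 * cmod (partials ks g x) \<le> C"
    using assms unfolding rapidly_decreasing_def by blast
  show ?thesis
    using C order_trans[OF norm_ge_zero C[of 0, simplified]] by (intro that[of C]) auto
qed

lemma norm_sum_coordinates_le:
  fixes h :: "real ^ 'n::finite" and d :: "'n \<Rightarrow> complex"
  assumes "\<And>k. cmod (d k) \<le> B k"
  shows "cmod (\<Sum>k\<in>UNIV. of_real (h $ k) * d k) \<le> norm h * (\<Sum>k\<in>UNIV. B k)"
  unfolding sum_distrib_left
  by (rule sum_norm_le) (use assms component_le_norm_cart[of h] in \<open>auto simp: norm_mult
      intro!: mult_mono\<close>)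

text \<open>Bounded second partials make the first partials Lipschitz, and linearization on the ball
  of radius norm h gives a quadratic remainder. The point is that \<open>M\<close> does not depend
  on z, so the remainder can be integrated over all translates.\<close>

lemma rapidly_decreasing_taylor:
  fixes g :: "real ^ 'n::finite \<Rightarrow> complex"
  assumes sm: "smooth g" and rd: "rapidly_decreasing g"
  obtains M where "0 \<le> M"
    "\<And>z h. cmod (g (z + h) - g z - (\<Sum>k\<in>UNIV. of_real (h $ k) * partial k g z)) \<le>
        M * norm h ^ 2"
proof -
  have "\<forall>k l. \<exists>C. 0 \<le> C \<and> (\<forall>x. cmod (partials [l, k] g x) \<le> C)"
    using rapidly_decreasing_bounded_partials[OF rd] by metis
  then obtain C where C: "\<And>k l. 0 \<le> C k l" "\<And>k l x. cmod (partial l (partial k g) x)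
      \<le> C k l"
    unfolding partials_Cons partials_Nil by metis
  define L where "L k = (\<Sum>l\<in>UNIV. C k l)" for k
  have L0: "0 \<le> L k" for k
    by (auto simp: L_def C intro: sum_nonneg)
  have diff: "partials ks g differentiable at x" for ks x
    using sm by (simp add: smooth_def)
  have lip: "cmod (partial k g y - partial k g z) \<le> L k * norm (y - z)" for k y z
  proof (rule differentiable_bound[OF convex_UNIV])
    show "(partial k g has_derivative (\<lambda>h. \<Sum>l\<in>UNIV. of_real (h $ l) * partial l
        (partial k g) x)) (at x within UNIV)" for x
      using smooth_has_derivative[of "partial k g" x] diff[of "[k]" x] by (simp add: partials_Cons)
    show "onorm (\<lambda>h. \<Sum>l\<in>UNIV. of_real (h $ l) * partial l (partial k g) x) \<le> L
        k" for x
      unfolding L_def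
      by (rule onorm_le, subst mult.commute, rule norm_sum_coordinates_le, rule C(2))
  qed auto
  define M where "M = (\<Sum>k\<in>UNIV. L k)"
  have "cmod (g (z + h) - g z - (\<Sum>k\<in>UNIV. of_real (h $ k) * partial k g z)) \<le> M * norm
      h ^ 2" for z h
  proof -
    let ?D = "\<lambda>x h. \<Sum>k\<in>UNIV. of_real (h $ k) * partial k g x"
    have "cmod (g (z + h) - g z - ?D z (z + h - z)) \<le> norm (z + h - z) * (norm h * M)"
    proof (rule differentiable_bound_linearization[where S="cball z (norm h)" and f'="?D"])
      fix x assume x: "x \<in> cball z (norm h)"
      show "(g has_derivative ?D x) (at x within cball z (norm h))"
        using smooth_has_derivative[of g x] diff[of "[]" x] by (auto intro: has_derivative_at_withinI)
      show "onorm (?D x - ?D z) \<le> norm h * M"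
      proof (rule onorm_le)
        fix y
        have "(?D x - ?D z) y = (\<Sum>k\<in>UNIV. of_real (y $ k) * (partial k g x - partial k g z))"
          by (simp add: sum_subtractf algebra_simps)
        also have "cmod \<dots> \<le> norm y * (\<Sum>k\<in>UNIV. L k * norm h)"
        proof (rule norm_sum_coordinates_le)
          fix k
          have "norm (x - z) \<le> norm h"
            using x by (simp add: dist_norm norm_minus_commute)
          then show "cmod (partial k g x - partial k g z) \<le> L k * norm h"
            using lip[of k x z] L0[of k] by (meson mult_left_mono order_trans)
        qed
        also have "\<dots> = norm h * M * norm y"
          by (simp add: M_def sum_distrib_right sum_distrib_left mult_ac)
        finally show "cmod ((?D x - ?D z) y) \<le> norm h * M * norm y" .
      qed
    qed (auto simp: dist_norm intro: mult_left_le_one_le)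
    then show ?thesis
      by (simp add: power2_eq_square mult_ac)
  qed
  moreover have "0 \<le> M"
    by (auto simp: M_def L0 intro: sum_nonneg)
  ultimately show ?thesis
    using that by blast
qed

lemma smooth_continuous_on: "smooth g \<Longrightarrow> continuous_on A g"
  using partials_Nil unfolding smooth_def
  by (metis differentiable_imp_continuous_within continuous_at_imp_continuous_on)

section \<open>Smoothness and decay of a convolution\<close>

definition conv_fun :: "(real ^ 'n::finite \<Rightarrow> complex) \<Rightarrow> (real ^ 'n
    \<Rightarrow> complex) \<Rightarrow> real ^ 'n \<Rightarrow> complex"
  where "conv_fun f g x = (LINT y|lborel. f y * g (x - y))"

text \<open>
  The surplus exponent \<open>CARD('n) + 2\<close> makes the bound integrable, so that convolving
  with a Schwartz function still leaves decay of order \<open>r\<close>.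
\<close>

definition decays :: "nat \<Rightarrow> (real ^ 'n::finite \<Rightarrow> complex) \<Rightarrow> bool"
  where "decays r f \<longleftrightarrow> continuous_on UNIV f \<and> (\<exists>C\<ge>0.
      \<forall>x. cmod (f x) \<le> C / (1 + norm x) ^ (r + (CARD('n) + 2)))"

lemma decays_mono:
  assumes "decays r f" "s \<le> r"
  shows "decays s f"
proof -
  obtain C where C: "0 \<le> C" "\<And>x. cmod (f x) \<le> C / (1 + norm x) ^ (r + (CARD('a) + 2))"
    using assms(1) by (auto simp: decays_def)
  have "cmod (f x) \<le> C / (1 + norm x) ^ (s + (CARD('a) + 2))" for x
  proof -
    have "(1 + norm x) ^ (s + (CARD('a) + 2)) \<le> (1 + norm x) ^ (r + (CARD('a) + 2))"
      using assms(2) by (intro power_increasing) auto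
    then show ?thesis
      using C(1) by (intro order_trans[OF C(2)] divide_left_mono mult_pos_pos) (auto simp:
          add_pos_nonneg)
  qed
  then show ?thesis
    using assms C(1) by (auto simp: decays_def)
qed

lemma integrable_weight_vec:
  "integrable lborel (\<lambda>x::real ^ 'n::finite. 1 / (1 + norm x) ^ (CARD('n) + 2))"
  using integrable_weight[where 'a="real ^ 'n"] by simp

lemma decays_integrable_mult:
  fixes f h :: "real ^ 'n::finite \<Rightarrow> complex"
  assumes "decays 0 f" and h: "continuous_on UNIV h" "\<And>x. cmod (h x) \<le> B"
  shows "integrable lborel (\<lambda>y. f y * h y)"
proof -
  obtain C where C: "continuous_on UNIV f" "0 \<le> C" "\<And>x. cmod (f x) \<le> C / (1 + norm x)
      ^ (CARD('n) + 2)"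
    using assms(1) by (auto simp: decays_def)
  show ?thesis
  proof (rule Bochner_Integration.integrable_bound)
    show "integrable lborel (\<lambda>y::real ^ 'n. (C * B) * (1 / (1 + norm y) ^ (CARD('n) + 2)))"
      by (intro integrable_mult_right integrable_weight_vec)
    show "(\<lambda>y. f y * h y) \<in> borel_measurable lborel"
      using C(1) h(1) by (intro borel_measurable_times) (auto intro: borel_measurable_continuous_onI)
    have "norm (f y * h y) \<le> (C / (1 + norm y) ^ (CARD('n) + 2)) * B" for y
      unfolding norm_mult using C h by (intro mult_mono) auto
    from order_trans[OF this abs_ge_self]
    have "norm (f y * h y) \<le> norm ((C * B) * (1 / (1 + norm y) ^ (CARD('n) + 2)))" for y
      by simp
    then show "AE y in lborel. norm (f y * h y) \<le> norm ((C * B) * (1 / (1 + norm y) ^ (CARD('n)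
        + 2)))"
      by (intro AE_I2)
  qed
qed

lemma conv_fun_integrable:
  fixes f g :: "real ^ 'n::finite \<Rightarrow> complex"
  assumes "decays r f" "smooth g" "rapidly_decreasing g"
  shows "integrable lborel (\<lambda>y. f y * g (x - y))"
proof -
  obtain B where "\<And>x. cmod (g x) \<le> B"
    using rapidly_decreasing_bounded_partials[OF assms(3), of "[]"] by auto
  moreover have "continuous_on UNIV (\<lambda>y. g (x - y))"
    by (rule continuous_on_compose2[OF smooth_continuous_on[OF assms(2), of UNIV]]) (auto intro!:
        continuous_intros)
  moreover have "decays 0 f"
    using assms(1) by (rule decays_mono) simp
  ultimately show ?thesis
    by (intro decays_integrable_mult) auto
qed

lemma schwartz_function_partials:
  assumes "smooth g" "rapidly_decreasing g"
  shows "smooth (partials ks g)" "rapidly_decreasing (partials ks g)"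
  using assms by (simp_all add: smooth_partials rapidly_decreasing_def flip: partials_append)

text \<open>Differentiation under the integral: the Taylor remainder of \<open>g\<close> is bounded
  uniformly in the base point x - y, so integrating it against the integrable \<open>f\<close>
  leaves an error of order norm h squared.\<close>

lemma conv_fun_has_derivative:
  fixes f g :: "real ^ 'n::finite \<Rightarrow> complex"
  assumes f: "decays r f" and g: "smooth g" "rapidly_decreasing g"
  shows "(conv_fun f g has_derivative (\<lambda>h. \<Sum>k\<in>UNIV. of_real (h $ k) * conv_fun f
      (partial k g) x)) (at x)"
proof -
  obtain M where M: "0 \<le> M"
    "\<And>z h. cmod (g (z + h) - g z - (\<Sum>k\<in>UNIV. of_real (h $ k) * partial k g z)) \<le>
        M * norm h ^ 2"
    using rapidly_decreasing_taylor[OF g] by blast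
  have gk: "smooth (partial k g)" "rapidly_decreasing (partial k g)" for k
    using schwartz_function_partials[OF g, of "[k]"] by (simp_all add: partials_Cons)
  note int = conv_fun_integrable[OF f g] and intk = conv_fun_integrable[OF f gk]
  have intf: "integrable lborel f"
    using decays_integrable_mult[of f "\<lambda>_. 1" 1] decays_mono[OF f] by simp
  define A where "A = (LINT y|lborel. cmod (f y))"
  have A0: "0 \<le> A"
    by (simp add: A_def)
  let ?D = "\<lambda>h. \<Sum>k\<in>UNIV. of_real (h $ k) * conv_fun f (partial k g) x"
  have est: "cmod (conv_fun f g (x + h) - conv_fun f g x - ?D h) \<le> (A * M) * norm h ^ 2" for h
  proof -
    let ?R = "\<lambda>y. g (x - y + h) - g (x - y) - (\<Sum>k\<in>UNIV. of_real (h $ k) * partial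
        k g (x - y))"
    have D: "?D h = (LINT y|lborel. (\<Sum>k\<in>UNIV. of_real (h $ k) * (f y * partial k g (x - y))))"
      by (subst Bochner_Integration.integral_sum) (auto intro!: intk integrable_mult_right simp:
          conv_fun_def)
    have intD: "integrable lborel (\<lambda>y. \<Sum>k\<in>UNIV. of_real (h $ k) * (f y * partial k
        g (x - y)))"
      by (intro Bochner_Integration.integrable_sum integrable_mult_right intk)
    have "conv_fun f g (x + h) - conv_fun f g x - ?D h
        = (LINT y|lborel. f y * g (x + h - y) - f y * g (x - y)
            - (\<Sum>k\<in>UNIV. of_real (h $ k) * (f y * partial k g (x - y))))"
      unfolding D unfolding conv_fun_def
      by (simp only: Bochner_Integration.integral_diff int intD Bochner_Integration.integrable_diff)
    also have "\<dots> = (LINT y|lborel. f y * ?R y)"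
      by (intro Bochner_Integration.integral_cong refl)
        (simp add: algebra_simps sum_distrib_left)
    also have "cmod \<dots> \<le> (LINT y|lborel. cmod (f y) * (M * norm h ^ 2))"
    proof (rule Bochner_Integration.integral_norm_bound_integral)
      have "integrable lborel (\<lambda>y. f y * g (x + h - y) - f y * g (x - y)
            - (\<Sum>k\<in>UNIV. of_real (h $ k) * (f y * partial k g (x - y))))"
        by (intro Bochner_Integration.integrable_diff int intD)
      also have "(\<lambda>y. f y * g (x + h - y) - f y * g (x - y)
            - (\<Sum>k\<in>UNIV. of_real (h $ k) * (f y * partial k g (x - y)))) = (\<lambda>y. f y
                * ?R y)"
        by (auto simp: algebra_simps sum_distrib_left)
      finally show "integrable lborel (\<lambda>y. f y * ?R y)" .
      show "integrable lborel (\<lambda>y. cmod (f y) * (M * norm h ^ 2))"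
        using intf by (intro integrable_mult_left integrable_norm)
      show "cmod (f y * ?R y) \<le> cmod (f y) * (M * norm h ^ 2)" for y
        unfolding norm_mult by (intro mult_left_mono M) auto
    qed
    also have "\<dots> = (A * M) * norm h ^ 2"
      using intf by (simp add: A_def)
    finally show ?thesis .
  qed
  have lin: "bounded_linear ?D"
    by (intro bounded_linear_sum bounded_linear_mult_left[THEN bounded_linear_compose]
        bounded_linear_of_real[THEN bounded_linear_compose] bounded_linear_vec_nth)
  show ?thesis
    unfolding has_derivative_at
  proof (intro conjI lin)
    show "(\<lambda>h. norm (conv_fun f g (x + h) - conv_fun f g x - ?D h) / norm h)
        \<midarrow>0\<rightarrow> 0"
    proof (rule Lim_null_comparison)
      show "eventually (\<lambda>h. norm (norm (conv_fun f g (x + h) - conv_fun f g x - ?D h) /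
          norm h) \<le> (A * M) * norm h) (at 0)"
        unfolding eventually_at_filter
      proof (intro always_eventually allI impI)
        fix h :: "real ^ 'n" assume "h \<noteq> 0"
        then show "norm (norm (conv_fun f g (x + h) - conv_fun f g x - ?D h) / norm h) \<le> (A *
            M) * norm h"
          using est[of h] by (simp add: divide_le_eq power2_eq_square mult.assoc)
      qed
      show "((\<lambda>h::real ^ 'n. (A * M) * norm h) \<longlongrightarrow> 0) (at 0)"
        by (auto intro!: tendsto_eq_intros)
    qed
  qed
qed

text \<open>The inequality 1 + norm x <= (1 + norm y) * (1 + norm (x - y)) splits the weight between
  the two factors. \<open>g\<close> absorbs its share by rapid decrease; \<open>f\<close> absorbs
  the other and keeps its surplus decay, which is the integrable weight.\<close>

lemma conv_fun_decay:
  fixes f g :: "real ^ 'n::finite \<Rightarrow> complex"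
  assumes f: "decays r f" and g: "smooth g" "rapidly_decreasing g"
  shows "\<exists>C. \<forall>x. (1 + norm x) ^ r * cmod (conv_fun f g x) \<le> C"
proof -
  let ?p = "CARD('n) + 2"
  obtain C where C: "0 \<le> C" "\<And>x. cmod (f x) \<le> C / (1 + norm x) ^ (r + ?p)"
    using f by (auto simp: decays_def)
  obtain B where B: "\<And>x. (1 + norm x) ^ r * cmod (g x) \<le> B"
    using g(2) unfolding rapidly_decreasing_def by (metis partials_Nil)
  have "(1 + norm x) ^ r * cmod (conv_fun f g x) \<le> (LINT y|lborel. C * B * (1 / (1 + norm (y ::
      real ^ 'n)) ^ ?p))" for x
  proof -
    have "(1 + norm x) ^ r * cmod (conv_fun f g x) = cmod (LINT y|lborel. (1 + norm x) ^ r
        *\<^sub>R (f y * g (x - y)))"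
      unfolding conv_fun_def by (simp add: power_abs)
    also have "\<dots> \<le> (LINT y|lborel. C * B * (1 / (1 + norm (y :: real ^ 'n)) ^ ?p))"
    proof (rule Bochner_Integration.integral_norm_bound_integral)
      show "integrable lborel (\<lambda>y. (1 + norm x) ^ r *\<^sub>R (f y * g (x - y)))"
        by (intro integrable_scaleR_right conv_fun_integrable[OF f g])
      show "integrable lborel (\<lambda>y::real ^ 'n. C * B * (1 / (1 + norm y) ^ ?p))"
        by (intro integrable_mult_right integrable_weight_vec)
      fix y
      have "norm x \<le> norm (x - y) + norm y"
        using norm_triangle_ineq[of "x - y" y] by simp
      moreover have "0 \<le> norm (x - y) * norm y"
        by simp
      moreover have "(1 + norm y) * (1 + norm (x - y)) = 1 + norm y + norm (x - y) + norm (x - y) *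
          norm y"
        by (simp add: distrib_left distrib_right)
      ultimately have "1 + norm x \<le> (1 + norm y) * (1 + norm (x - y))"
        by linarith
      then have "(1 + norm x) ^ r \<le> (1 + norm y) ^ r * (1 + norm (x - y)) ^ r"
        by (metis power_mono power_mult_distrib add_nonneg_nonneg norm_ge_zero zero_le_one)
      then have "norm ((1 + norm x) ^ r *\<^sub>R (f y * g (x - y)))
          \<le> ((1 + norm y) ^ r * (1 + norm (x - y)) ^ r) * (cmod (f y) * cmod (g (x - y)))"
        by (auto simp: norm_mult power_abs intro!: mult_right_mono)
      also have "\<dots> = ((1 + norm y) ^ r * cmod (f y)) * ((1 + norm (x - y)) ^ r * cmod (g (x -
          y)))"
        by (simp add: mult_ac)
      also have "\<dots> \<le> ((1 + norm y) ^ r * (C / (1 + norm y) ^ (r + ?p))) * B"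
        using C by (intro mult_mono B mult_left_mono) (auto intro!: mult_nonneg_nonneg
            divide_nonneg_nonneg)
      also have "\<dots> = C * B * (1 / (1 + norm y) ^ ?p)"
      proof -
        have "(1 + norm y) ^ r \<noteq> 0"
          by (metis add_pos_nonneg less_irrefl norm_ge_zero power_not_zero zero_less_one)
        then show ?thesis
          by (simp add: power_add)
      qed
      finally show "norm ((1 + norm x) ^ r *\<^sub>R (f y * g (x - y))) \<le> C * B * (1 / (1 +
          norm y) ^ ?p)" .
    qed
    finally show ?thesis .
  qed
  then show ?thesis
    by blast
qed

text \<open>Every derivative is put on \<open>g i\<close>, so the merely continuous
  \<open>f i\<close> is never differentiated. Finite sums with coefficients are the form that the
  structure of \<open>OC\<close> produces.\<close>

lemma partials_sum_conv_fun:
  fixes f g :: "'i \<Rightarrow> real ^ 'n::finite \<Rightarrow> complex"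
  assumes f: "\<And>i. i \<in> I \<Longrightarrow> decays r (f i)"
    and g: "\<And>i. i \<in> I \<Longrightarrow> smooth (g i)" "\<And>i. i \<in> I
        \<Longrightarrow> rapidly_decreasing (g i)"
  shows "partials ks (\<lambda>x. \<Sum>i\<in>I. c i * conv_fun (f i) (g i) x)
    = (\<lambda>x. \<Sum>i\<in>I. c i * conv_fun (f i) (partials ks (g i)) x)" (is "?P ks")
    and "partials ks (\<lambda>x. \<Sum>i\<in>I. c i * conv_fun (f i) (g i) x) differentiable at x"
proof -
  have D: "((\<lambda>x. \<Sum>i\<in>I. c i * conv_fun (f i) (partials ks (g i)) x) has_derivative
     (\<lambda>h. \<Sum>k\<in>UNIV. of_real (h $ k) * (\<Sum>i\<in>I. c i * conv_fun (f i)
         (partials (k # ks) (g i)) x))) (at x)" for ks x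
  proof -
    have "((\<lambda>x. \<Sum>i\<in>I. c i * conv_fun (f i) (partials ks (g i)) x) has_derivative
      (\<lambda>h. \<Sum>i\<in>I. c i * (\<Sum>k\<in>UNIV. of_real (h $ k) * conv_fun (f i)
          (partials (k # ks) (g i)) x))) (at x)"
      unfolding partials_Cons
      by (intro has_derivative_sum has_derivative_mult_right conv_fun_has_derivative[where r=r] f
          schwartz_function_partials g)
    moreover have "(\<Sum>i\<in>I. c i * (\<Sum>k\<in>UNIV. of_real (h $ k) * conv_fun (f i)
        (partials (k # ks) (g i)) x))
      = (\<Sum>k\<in>UNIV. of_real (h $ k) * (\<Sum>i\<in>I. c i * conv_fun (f i) (partials (k #
          ks) (g i)) x))" for h :: "real ^ 'n"
      unfolding sum_distrib_left by (subst sum.swap) (simp add: mult_ac)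
    ultimately show ?thesis
      by simp
  qed
  have P: "?P ks" for ks
  proof (induction ks)
    case (Cons k ks)
    show ?case
      using has_derivative_imp_partial[OF D] by (simp only: partials_Cons[of k ks "\<lambda>x.
          \<Sum>i\<in>I. c i * conv_fun (f i) (g i) x"] Cons.IH fun_eq_iff) simp
  qed simp
  show "?P ks"
    by (rule P)
  show "partials ks (\<lambda>x. \<Sum>i\<in>I. c i * conv_fun (f i) (g i) x) differentiable at x"
    unfolding P using D by (rule differentiableI)
qed

section \<open>Convolution operators on the Schwartz space\<close>

lemma schwartz_fun_add: "schwartz_fun (\<phi> + \<psi>) x = schwartz_fun \<phi> x + schwartz_fun
    \<psi> x"
  by (simp add: plus_schwartz.rep_eq)

lemma schwartz_fun_zero: "schwartz_fun 0 x = 0"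
  by (simp add: zero_schwartz.rep_eq)

lemma schwartz_fun_scaleC: "schwartz_fun (c *\<^sub>C \<phi>) x = c * schwartz_fun \<phi> x"
  by (simp add: scaleC_schwartz.rep_eq)

lemma schwartz_fun_sum: "schwartz_fun (\<Sum>i\<in>I. \<phi> i) x = (\<Sum>i\<in>I. schwartz_fun
    (\<phi> i) x)"
  by (induction I rule: infinite_finite_induct) (simp_all add: schwartz_fun_zero schwartz_fun_add)

lemma schwartz_eqI: "(\<And>x. schwartz_fun \<phi> x = schwartz_fun \<psi> x) \<Longrightarrow>
    \<phi> = \<psi>"
  by (rule iffD1[OF schwartz_fun_inject]) (rule ext)

lemma apply_dist_test_add: "apply_dist T (\<phi> + \<psi>) = apply_dist T \<phi> + apply_dist T \<psi>"
  using apply_dist[of T] by simp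

lemma apply_dist_test_scaleC: "apply_dist T (c *\<^sub>C \<phi>) = c * apply_dist T \<phi>"
  using apply_dist[of T] by simp

lemma apply_dist_continuous: "continuous_map schwartz_topology euclidean (apply_dist T)"
  using apply_dist[of T] by simp

lemma apply_dist_test_zero: "apply_dist T 0 = 0"
  using apply_dist_test_add[of T 0 0] by simp

lemma apply_dist_test_sum: "apply_dist T (\<Sum>i\<in>I. \<phi> i) = (\<Sum>i\<in>I. apply_dist T
    (\<phi> i))"
  by (induction I rule: infinite_finite_induct)
    (simp_all add: apply_dist_test_zero apply_dist_test_add)

lemma apply_dist_test_minus: "apply_dist T (- \<phi>) = - apply_dist T \<phi>"
  by (simp add: uminus_schwartz_def apply_dist_test_scaleC)

lemma apply_dist_test_diff: "apply_dist T (\<phi> - \<psi>) = apply_dist T \<phi> - apply_dist T \<psi>"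
  unfolding minus_schwartz_def apply_dist_test_add apply_dist_test_minus by simp

lemma apply_dist_zero [simp]: "apply_dist 0 \<phi> = 0"
  by (simp add: zero_tempered.rep_eq)

lemma apply_dist_add [simp]: "apply_dist (S + T) \<phi> = apply_dist S \<phi> + apply_dist T \<phi>"
  by (simp add: plus_tempered.rep_eq)

lemma apply_dist_scaleC [simp]: "apply_dist (c *\<^sub>C T) \<phi> = c * apply_dist T \<phi>"
  by (simp add: scaleC_tempered.rep_eq)

lemma apply_dist_scaleR [simp]: "apply_dist (r *\<^sub>R T) \<phi> = of_real r * apply_dist T \<phi>"
  by (simp add: scaleR_tempered_def)

lemma apply_dist_uminus [simp]: "apply_dist (- T) \<phi> = - apply_dist T \<phi>"
  by (simp add: uminus_tempered_def)

lemma apply_dist_diff [simp]: "apply_dist (S - T) \<phi> = apply_dist S \<phi> - apply_dist T \<phi>"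
  unfolding minus_tempered_def apply_dist_add apply_dist_uminus by simp

lemma apply_dist_sum [simp]: "apply_dist (\<Sum>i\<in>I. T i) \<phi> = (\<Sum>i\<in>I. apply_dist
    (T i) \<phi>)"
  by (induction I rule: infinite_finite_induct) simp_all

lemma tempered_eqI: "(\<And>\<phi>. apply_dist S \<phi> = apply_dist T \<phi>) \<Longrightarrow> S = T"
  by (rule iffD1[OF apply_dist_inject]) (rule ext)

lemma reflect_reflect [simp]: "reflect (reflect \<phi>) = \<phi>"
  by (rule schwartz_eqI) (simp add: reflect.rep_eq)

lemma reflect_add: "reflect (\<phi> + \<psi>) = reflect \<phi> + reflect \<psi>"
  by (rule schwartz_eqI) (simp add: reflect.rep_eq schwartz_fun_add)

lemma reflect_scaleC: "reflect (c *\<^sub>C \<phi>) = c *\<^sub>C reflect \<phi>"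
  by (rule schwartz_eqI) (simp add: reflect.rep_eq schwartz_fun_scaleC)

lemma reflect_diff: "reflect (\<phi> - \<psi>) = reflect \<phi> - reflect \<psi>"
  unfolding minus_schwartz_def uminus_schwartz_def reflect_add reflect_scaleC ..

lemma translate_translate: "translate x (translate y \<phi>) = translate (x + y) \<phi>"
  by (rule schwartz_eqI) (simp add: translate.rep_eq add_ac)

lemma schwartz_partial_reflect:
  "schwartz_partial k (reflect \<phi>) = (- 1) *\<^sub>C reflect (schwartz_partial k \<phi>)"
proof (transfer, elim conjE)
  fix k :: 'a and f :: "real ^ 'a \<Rightarrow> complex"
  assume "smooth f"
  from partials_reflect[OF this, of "[k]"]
  show "partial k (\<lambda>x. f (- x)) = (\<lambda>x. - 1 * partial k f (- x))"
    by (simp add: partials_Cons)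
qed

lemma schwartz_partial_translate:
  "schwartz_partial k (translate x \<phi>) = translate x (schwartz_partial k \<phi>)"
proof transfer
  fix k :: 'a and x and f :: "real ^ 'a \<Rightarrow> complex"
  from partials_translate[of "[k]" f x]
  show "partial k (\<lambda>y. f (x + y)) = (\<lambda>y. partial k f (x + y))"
    by (simp add: partials_Cons)
qed

text \<open>Each derivative crossing the reflection contributes a sign. The scalar \<open>c\<close>
  accumulates the signs of the derivatives already taken in the other coordinates.\<close>

lemma schwartz_partial_power_reflect_translate:
  "(schwartz_partial k ^^ n) (c *\<^sub>C reflect (translate x \<phi>))
    = ((- 1) ^ n * c) *\<^sub>C reflect (translate x ((schwartz_partial k ^^ n) \<phi>))"
  by (induction n)
    (simp_all add: schwartz_partial_scaleC schwartz_partial_reflect schwartz_partial_translate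
      scaleC_scaleC)

text \<open>The total sign stays a sum over the enumeration \<open>coordinates\<close>; it is
  absorbed into the coefficients in \<open>OC_conv_representation\<close>.\<close>

lemma mi_power_reflect_translate:
  "mi_power schwartz_partial \<alpha> (reflect (translate x \<phi>))
    = (- 1) ^ sum_list (map (Poly_Mapping.lookup \<alpha>) coordinates)
      *\<^sub>C reflect (translate x (mi_power schwartz_partial \<alpha> \<phi>))"
proof -
  have "foldr (\<lambda>k. schwartz_partial k ^^ Poly_Mapping.lookup \<alpha> k) ks (reflect
      (translate x \<phi>))
    = (- 1) ^ sum_list (map (Poly_Mapping.lookup \<alpha>) ks)
      *\<^sub>C reflect (translate x (foldr (\<lambda>k. schwartz_partial k ^^ Poly_Mapping.lookup
          \<alpha> k) ks \<phi>))" for ks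
    by (induction ks) (simp_all add: scaleC_one schwartz_partial_power_reflect_translate power_add)
  then show ?thesis
    by (simp add: mi_power_def)
qed

section \<open>Elements of \<open>OC\<close> map Schwartz functions to Schwartz functions\<close>

lemma OC_conv_representation:
  fixes T :: "'n::finite tempered"
  assumes "T \<in> OC"
  obtains I :: "'n multi_index set" and c f where "\<And>\<alpha>. \<alpha> \<in> I
      \<Longrightarrow> decays N (f \<alpha>)"
    "\<And>x. apply_dist T (reflect (translate x \<phi>))
      = (\<Sum>\<alpha>\<in>I. c \<alpha> * conv_fun (f \<alpha>) (schwartz_fun (mi_power
          schwartz_partial \<alpha> \<phi>)) x)"
proof -
  \<comment> \<open>Decay of this order in the definition of \<open>OC\<close> is exactly what
    \<open>decays N\<close> asks for.\<close>
  let ?r = "N + (CARD('n) + 2)"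
  obtain m and f :: "'n multi_index \<Rightarrow> real ^ 'n \<Rightarrow> complex"
    where f: "\<And>\<alpha>. mi_order \<alpha> \<le> m \<Longrightarrow> continuous_on UNIV (f
        \<alpha>)"
      "\<And>\<alpha>. mi_order \<alpha> \<le> m \<Longrightarrow> f \<alpha> \<in>
          O[at_infinity](\<lambda>x. complex_of_real (1 / norm x ^ ?r))"
    and T: "\<And>\<phi>. apply_dist T \<phi> = (\<Sum>\<alpha> | mi_order \<alpha> \<le> m. (- 1)
        ^ mi_order \<alpha> *
      (LINT x|lborel. f \<alpha> x * schwartz_fun (mi_power schwartz_partial \<alpha> \<phi>) x))"
    using assms[unfolded OC_def mem_Collect_eq, rule_format, of ?r] by blast
  let ?s = "\<lambda>\<alpha>. (- 1) ^ sum_list (map (Poly_Mapping.lookup \<alpha>) coordinates) ::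
      complex"
  show ?thesis
  proof (rule that)
    fix \<alpha> assume "\<alpha> \<in> {\<alpha> :: 'n multi_index. mi_order \<alpha> \<le> m}"
    then have \<alpha>: "mi_order \<alpha> \<le> m" by simp
    from continuous_bigo_bound[OF f(1)[OF \<alpha>] f(2)[OF \<alpha>]]
    show "decays N (f \<alpha>)"
      using f(1)[OF \<alpha>] unfolding decays_def by metis
  next
    fix x
    have "(LINT y|lborel. f \<alpha> y * schwartz_fun (mi_power schwartz_partial \<alpha> (reflect
        (translate x \<phi>))) y)
      = ?s \<alpha> * conv_fun (f \<alpha>) (schwartz_fun (mi_power schwartz_partial \<alpha>
          \<phi>)) x" for \<alpha>
    proof -
      have eq: "f \<alpha> y * schwartz_fun (mi_power schwartz_partial \<alpha> (reflect (translate
          x \<phi>))) y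
        = ?s \<alpha> * (f \<alpha> y * schwartz_fun (mi_power schwartz_partial \<alpha> \<phi>) (x
            - y))" for y
        by (simp add: mi_power_reflect_translate schwartz_fun_scaleC reflect.rep_eq translate.rep_eq)
      show ?thesis
        unfolding conv_fun_def eq by simp
    qed
    then show "apply_dist T (reflect (translate x \<phi>))
      = (\<Sum>\<alpha> | mi_order \<alpha> \<le> m. ((- 1) ^ mi_order \<alpha> * ?s \<alpha>)
          * conv_fun (f \<alpha>) (schwartz_fun (mi_power schwartz_partial \<alpha> \<phi>)) x)"
      by (simp add: T mult.assoc)
  qed
qed

text \<open>One representation controls the decay only up to its own order, so rapid decrease takes
  a new representation for each power \<open>N\<close>, while smoothness can be read off from the
  one for order 0.\<close>

lemma OC_conv_schwartz:
  assumes "T \<in> OC"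
  shows "smooth (\<lambda>x. apply_dist T (reflect (translate x \<phi>)))"
    and "rapidly_decreasing (\<lambda>x. apply_dist T (reflect (translate x \<phi>)))"
proof -
  let ?g = "\<lambda>\<alpha>. schwartz_fun (mi_power schwartz_partial \<alpha> \<phi>)"
  have g: "smooth (?g \<alpha>)" "rapidly_decreasing (?g \<alpha>)" for \<alpha>
    using schwartz_fun[of "mi_power schwartz_partial \<alpha> \<phi>"] by auto
  show "smooth (\<lambda>x. apply_dist T (reflect (translate x \<phi>)))"
  proof -
    obtain I c f where f: "\<And>\<alpha>. \<alpha> \<in> I \<Longrightarrow> decays 0 (f \<alpha>)"
      and T: "\<And>x. apply_dist T (reflect (translate x \<phi>)) = (\<Sum>\<alpha>\<in>I. c
          \<alpha> * conv_fun (f \<alpha>) (?g \<alpha>) x)"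
      by (rule OC_conv_representation[OF assms, of 0 \<phi>]) blast
    show ?thesis
      unfolding T smooth_def by (intro allI partials_sum_conv_fun(2)[where r = 0] f g)
  qed
  show "rapidly_decreasing (\<lambda>x. apply_dist T (reflect (translate x \<phi>)))"
  proof (rule rapidly_decreasingI)
    fix N ks
    obtain I c f where f: "\<And>\<alpha>. \<alpha> \<in> I \<Longrightarrow> decays N (f \<alpha>)"
      and T: "\<And>x. apply_dist T (reflect (translate x \<phi>)) = (\<Sum>\<alpha>\<in>I. c
          \<alpha> * conv_fun (f \<alpha>) (?g \<alpha>) x)"
      by (rule OC_conv_representation[OF assms, of N \<phi>]) blast
    have "\<forall>\<alpha>\<in>I. \<exists>C. \<forall>x. (1 + norm x) ^ N * cmod (conv_fun (f
        \<alpha>) (partials ks (?g \<alpha>)) x) \<le> C"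
      by (intro ballI conv_fun_decay f schwartz_function_partials g)
    then obtain C where C: "\<And>\<alpha> x. \<alpha> \<in> I \<Longrightarrow> (1 + norm x) ^ N *
        cmod (conv_fun (f \<alpha>) (partials ks (?g \<alpha>)) x) \<le> C \<alpha>"
      by metis
    have "(1 + norm x) ^ N * cmod (\<Sum>\<alpha>\<in>I. c \<alpha> * conv_fun (f \<alpha>)
        (partials ks (?g \<alpha>)) x)
      \<le> (\<Sum>\<alpha>\<in>I. cmod (c \<alpha>) * C \<alpha>)" for x
    proof -
      have "(1 + norm x) ^ N * cmod (\<Sum>\<alpha>\<in>I. c \<alpha> * conv_fun (f \<alpha>)
          (partials ks (?g \<alpha>)) x)
        \<le> (1 + norm x) ^ N * (\<Sum>\<alpha>\<in>I. cmod (c \<alpha>) * cmod (conv_fun (f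
            \<alpha>) (partials ks (?g \<alpha>)) x))"
        by (intro mult_left_mono sum_norm_le) (auto simp: norm_mult)
      also have "\<dots> = (\<Sum>\<alpha>\<in>I. cmod (c \<alpha>) * ((1 + norm x) ^ N * cmod
          (conv_fun (f \<alpha>) (partials ks (?g \<alpha>)) x)))"
        by (simp add: sum_distrib_left mult_ac)
      also have "\<dots> \<le> (\<Sum>\<alpha>\<in>I. cmod (c \<alpha>) * C \<alpha>)"
        by (intro sum_mono mult_left_mono C) auto
      finally show ?thesis .
    qed
    then show "\<exists>C. \<forall>x. (1 + norm x) ^ N * cmod (partials ks (\<lambda>x. apply_dist
        T (reflect (translate x \<phi>))) x) \<le> C"
      unfolding T by (subst partials_sum_conv_fun(1)[where r = N]) (use f g in auto)
  qed
qed

text \<open>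
  Excludes the junk value that \<^const>\<open>conv_test\<close> takes when \<open>T * \<phi>\<close> is not a
  Schwartz function.
\<close>

definition convolver :: "'n::finite tempered \<Rightarrow> bool"
  where "convolver T \<longleftrightarrow> conv_test T \<in> schwartz_operators \<and>
    (\<forall>\<phi> x. schwartz_fun (conv_test T \<phi>) x = apply_dist T (reflect (translate x
        \<phi>)))"

lemma convolver_fun:
  "convolver T \<Longrightarrow> schwartz_fun (conv_test T \<phi>) x = apply_dist T (reflect
      (translate x \<phi>))"
  by (simp add: convolver_def)

text \<open>A Schwartz function is determined by its values, so any continuous linear operator with
  the right pointwise values must be \<open>conv_test T\<close>. This is how the closure properties
  below are proved: exhibit the operator and compute its values.\<close>

lemma convolverI:
  assumes "A \<in> schwartz_operators" "\<And>\<phi> x. schwartz_fun (A \<phi>) x = apply_dist T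
      (reflect (translate x \<phi>))"
  shows "convolver T" "conv_test T = A"
proof -
  show A: "conv_test T = A"
    by (auto simp: conv_test_def schwartz_fun_inverse simp flip: assms(2))
  show "convolver T"
    using assms by (simp add: convolver_def A)
qed

section \<open>The topology of \<open>OC\<close> and evaluation at a test function\<close>

lemma topspace_compact_open: "topspace compact_open_topology \<subseteq> schwartz_operators"
  by (auto simp: compact_open_topology_def)

text \<open>Continuity of the operator is part of lying in the carrier of the pullback topology; the
  pointwise formula comes from \<open>OC_conv_schwartz\<close>.\<close>

lemma OC_topspace_convolver:
  assumes "T \<in> topspace OC_topology"
  shows "convolver T"
proof -
  have T: "T \<in> OC" "conv_test T \<in> schwartz_operators"
    using assms topspace_compact_open by (auto simp: OC_topology_def topspace_pullback_topology)
  show ?thesis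
    using T(2) OC_conv_schwartz[OF T(1)] by (auto simp: convolver_def conv_test_def Schwartz_inverse)
qed

text \<open>A singleton is compact, so the operators sending phi into an open set form a subbasic
  set of the compact-open topology. Evaluation at phi is therefore continuous.\<close>

lemma continuous_map_conv_test:
  fixes \<phi> :: "'n::finite schwartz"
  shows "continuous_map OC_topology schwartz_topology (\<lambda>T. conv_test T \<phi>)"
proof -
  have "continuous_map compact_open_topology schwartz_topology (\<lambda>A :: 'n schwartz
      \<Rightarrow> 'n schwartz. A \<phi>)"
    unfolding continuous_map_def
  proof (intro conjI allI impI)
    fix U :: "'n schwartz set"
    assume U: "openin schwartz_topology U"
    have "openin compact_open_topology {A \<in> schwartz_operators. A ` {\<phi>} \<subseteq> U}"
      unfolding compact_open_topology_def using U
      by (intro topology_generated_by_Basis CollectI exI[of _ "{\<phi>}"] exI[of _ U]) simp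
    moreover from openin_subset[OF this]
    have "{A :: 'n schwartz \<Rightarrow> 'n schwartz. A \<in> topspace compact_open_topology
        \<and> A \<phi> \<in> U} = {A \<in> schwartz_operators. A ` {\<phi>} \<subseteq> U}"
      using topspace_compact_open by auto
    ultimately show "openin compact_open_topology {A :: 'n schwartz \<Rightarrow> 'n schwartz. A
        \<in> topspace compact_open_topology \<and> A \<phi> \<in> U}"
      by simp
  qed simp
  then show ?thesis
    unfolding OC_topology_def using continuous_map_pullback by (fastforce simp: o_def)
qed

lemma schwartz_seminorm_reflect: "schwartz_seminorm N ks (reflect \<phi>) = schwartz_seminorm N ks
    \<phi>"
proof -
  have "partials ks (\<lambda>x. schwartz_fun \<phi> (- x)) = (\<lambda>x. (- 1) ^ length ks *
      partials ks (schwartz_fun \<phi>) (- x))"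
    by (rule partials_reflect) (use schwartz_fun[of \<phi>] in auto)
  moreover have "(SUP x. h (- x)) = (SUP x. h x)" for h :: "real ^ 'a \<Rightarrow> real"
  proof -
    have "range (\<lambda>x. h (- x)) = range h"
      by (auto simp: image_iff) (metis minus_minus)
    then show ?thesis
      by simp
  qed
  from this[of "\<lambda>x. (1 + norm x) ^ N * cmod (partials ks (schwartz_fun \<phi>) x)"]
  have "(SUP x. (1 + norm x) ^ N * cmod (partials ks (schwartz_fun \<phi>) (- x)))
      = (SUP x. (1 + norm x) ^ N * cmod (partials ks (schwartz_fun \<phi>) x))"
    by simp
  ultimately show ?thesis
    by (simp add: schwartz_seminorm_def reflect.rep_eq norm_mult norm_power)
qed

lemma continuous_map_reflect: "continuous_map schwartz_topology schwartz_topology reflect"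
proof -
  have "continuous_map schwartz_topology
      (seminorm_topology {schwartz_seminorm N ks | N (ks :: 'a list). True}) reflect"
  proof (rule continuous_map_into_seminorm_topology)
    fix p :: "'a schwartz \<Rightarrow> real" and \<phi> and e :: real
    assume "p \<in> {schwartz_seminorm N ks |N ks. True}" and e: "0 < e"
    then obtain N ks where p: "p = schwartz_seminorm N ks"
      by blast
    show "\<exists>V. openin schwartz_topology V \<and> \<phi> \<in> V \<and>
        (\<forall>\<psi>\<in>V. p (reflect \<psi> - reflect \<phi>) < e)"
      using openin_schwartz_ball[OF e, of N ks \<phi>] e
      by (intro exI[of _ "{\<psi>. schwartz_seminorm N ks (\<psi> - \<phi>) < e}"])
        (auto simp: p schwartz_seminorm_reflect simp flip: reflect_diff)
  qed (use schwartz_seminorm_triangle in auto)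
  then show ?thesis
    unfolding schwartz_topology_def[symmetric] .
qed

lemma schwartz_operators_comp:
  assumes "A \<in> schwartz_operators" "B \<in> schwartz_operators"
  shows "(\<lambda>\<phi>. A (B \<phi>)) \<in> schwartz_operators"
  using assms continuous_map_compose[of schwartz_topology schwartz_topology B schwartz_topology A]
  by (auto simp: schwartz_operators_def o_def)

lemma reflect_schwartz_operator: "reflect \<in> schwartz_operators"
  by (simp add: schwartz_operators_def reflect_add reflect_scaleC continuous_map_reflect)

lemma id_schwartz_operator: "(\<lambda>\<phi>. \<phi>) \<in> schwartz_operators"
  by (simp add: schwartz_operators_def)

lemma partial_schwartz_operator: "schwartz_partial k \<in> schwartz_operators"
  by (simp add: schwartz_operators_def schwartz_partial_add schwartz_partial_scaleC
      continuous_map_schwartz_partial)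

section \<open>The transpose of convolution and the convolution calculus\<close>

definition conv_adjoint :: "'n::finite tempered \<Rightarrow> 'n schwartz \<Rightarrow> 'n schwartz"
  where "conv_adjoint T \<phi> = reflect (conv_test T (reflect \<phi>))"

lemma conv_adjoint_schwartz_operator:
  assumes "convolver T"
  shows "conv_adjoint T \<in> schwartz_operators"
proof -
  have "conv_test T \<in> schwartz_operators"
    using assms by (simp add: convolver_def)
  from schwartz_operators_comp[OF reflect_schwartz_operator
      schwartz_operators_comp[OF this reflect_schwartz_operator]]
  show ?thesis
    unfolding conv_adjoint_def[abs_def] .
qed

text \<open>Removes the abstraction function in \<open>conv\<close>: for a convolver the composed
  functional is continuous and linear, so \<open>Tempered\<close> does not return an arbitrary
  value.\<close>

lemma apply_dist_conv:
  assumes "convolver T"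
  shows "apply_dist (conv T u) \<phi> = apply_dist u (conv_adjoint T \<phi>)"
proof -
  have A: "conv_adjoint T \<in> schwartz_operators"
    by (rule conv_adjoint_schwartz_operator) fact
  have "continuous_map schwartz_topology euclidean (\<lambda>\<phi>. apply_dist u (conv_adjoint T
      \<phi>))"
    using continuous_map_compose[of schwartz_topology schwartz_topology "conv_adjoint T" euclidean
        "apply_dist u"]
      A apply_dist_continuous[of u] by (auto simp: schwartz_operators_def o_def)
  then have "(\<lambda>\<phi>. apply_dist u (conv_adjoint T \<phi>)) \<in> {T.
      (\<forall>\<phi> \<psi>. T (\<phi> + \<psi>) = T \<phi> + T \<psi>) \<and> (\<forall>c
          \<phi>. T (c *\<^sub>C \<phi>) = c * T \<phi>) \<and>
      continuous_map schwartz_topology euclidean T}"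
    using A by (auto simp: schwartz_operators_def apply_dist_test_add apply_dist_test_scaleC)
  then show ?thesis
    by (simp add: conv_def Tempered_inverse flip: conv_adjoint_def)
qed

lemma conv_test_translate:
  "convolver T \<Longrightarrow> conv_test T (translate x \<phi>) = translate x (conv_test T \<phi>)"
  by (rule schwartz_eqI)
    (simp add: convolver_fun translate.rep_eq translate_translate add.commute)

text \<open>Convolution operators commute with translations, hence evaluating
  \<open>conv S T\<close> at a reflected translate gives the composition of the two operators at a
  point. Transposition reverses the order of the factors.\<close>

lemma convolver_conv:
  assumes S: "convolver S" and T: "convolver T"
  shows "convolver (conv S T)" "conv_adjoint (conv S T) \<phi> = conv_adjoint T (conv_adjoint S \<phi>)"
proof -
  have eq: "schwartz_fun (conv_test T (conv_test S \<phi>)) x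
      = apply_dist (conv S T) (reflect (translate x \<phi>))" for \<phi> x
    by (simp add: apply_dist_conv S T conv_adjoint_def conv_test_translate convolver_fun)
  have op: "(\<lambda>\<phi>. conv_test T (conv_test S \<phi>)) \<in> schwartz_operators"
    using S T by (simp add: schwartz_operators_comp convolver_def)
  show "convolver (conv S T)"
    by (rule convolverI(1)[OF op eq])
  show "conv_adjoint (conv S T) \<phi> = conv_adjoint T (conv_adjoint S \<phi>)"
    by (simp add: conv_adjoint_def convolverI(2)[OF op eq])
qed

lemma convolver_dirac:
  fixes \<phi> :: "'n::finite schwartz"
  shows "convolver (dirac :: 'n tempered)" "conv_adjoint dirac \<phi> = \<phi>"
proof -
  have eq: "schwartz_fun \<phi> x = apply_dist dirac (reflect (translate x \<phi>))" for x and
      \<phi> :: "'n schwartz"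
    by (simp add: dirac.rep_eq reflect.rep_eq translate.rep_eq)
  show "convolver (dirac :: 'n tempered)"
    by (rule convolverI(1)[OF id_schwartz_operator eq])
  show "conv_adjoint dirac \<phi> = \<phi>"
    by (simp add: conv_adjoint_def convolverI(2)[OF id_schwartz_operator eq])
qed

lemma apply_dist_tempered_partial:
  "apply_dist (tempered_partial k T) \<phi> = - apply_dist T (schwartz_partial k \<phi>)"
  by (simp add: tempered_partial.rep_eq)

text \<open>The sign in the distributional derivative cancels the sign from the reflection, so the
  operator of the derivative is phi mapped to T convolved with the derivative of phi.\<close>

lemma convolver_tempered_partial:
  assumes T: "convolver T"
  shows "convolver (tempered_partial k T)"
    "conv (tempered_partial k T) u = tempered_partial k (conv T u)"
proof -
  have eq: "schwartz_fun (conv_test T (schwartz_partial k \<phi>)) x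
      = apply_dist (tempered_partial k T) (reflect (translate x \<phi>))" for \<phi> x
    by (simp add: apply_dist_tempered_partial schwartz_partial_reflect
        schwartz_partial_translate apply_dist_test_scaleC convolver_fun T)
  have op: "(\<lambda>\<phi>. conv_test T (schwartz_partial k \<phi>)) \<in> schwartz_operators"
    using T by (intro schwartz_operators_comp[OF _ partial_schwartz_operator]) (simp add: convolver_def)
  show c: "convolver (tempered_partial k T)"
    by (rule convolverI(1)[OF op eq])
  have "conv_adjoint (tempered_partial k T) \<phi> = (- 1) *\<^sub>C conv_adjoint T
      (schwartz_partial k \<phi>)" for \<phi>
    using T by (simp add: conv_adjoint_def convolverI(2)[OF op eq] schwartz_partial_reflect
        reflect_scaleC
        convolver_def schwartz_operators_def)
  then show "conv (tempered_partial k T) u = tempered_partial k (conv T u)"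
    by (intro tempered_eqI)
      (simp add: apply_dist_conv[OF c] apply_dist_conv[OF T] apply_dist_tempered_partial
          apply_dist_test_scaleC)
qed

text \<open>The two claims are proved together because moving each further derivative out of the
  convolution requires the distribution reached so far to be a convolver.\<close>

lemma conv_mi_power:
  assumes T: "convolver T"
  shows "convolver (mi_power tempered_partial \<alpha> T)
    \<and> conv (mi_power tempered_partial \<alpha> T) u = mi_power tempered_partial \<alpha> (conv
        T u)"
proof -
  have power: "convolver ((tempered_partial k ^^ n) T)
    \<and> conv ((tempered_partial k ^^ n) T) u = (tempered_partial k ^^ n) (conv T u)"
    if "convolver T" for k n and T u :: "'a tempered"
    using that by (induction n) (auto simp: convolver_tempered_partial)
  have "convolver (foldr (\<lambda>k. tempered_partial k ^^ Poly_Mapping.lookup \<alpha> k) ks T)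
    \<and> conv (foldr (\<lambda>k. tempered_partial k ^^ Poly_Mapping.lookup \<alpha> k) ks T) u
      = foldr (\<lambda>k. tempered_partial k ^^ Poly_Mapping.lookup \<alpha> k) ks (conv T u)" for ks
    by (induction ks) (use T power in auto)
  then show ?thesis
    by (simp add: mi_power_def)
qed

text \<open>Compared pointwise, both sides reduce to linearity of evaluation. That \<open>R\<close>
  is a convolver is assumed here; at the uses it comes from membership in the carrier of
  \<open>OC_topology\<close> or from a direct argument.\<close>

lemma conv_adjoint_sum:
  fixes R :: "'n::finite tempered"
  assumes R: "convolver R" and T: "\<And>i. i \<in> I \<Longrightarrow> convolver (T i)"
    and eq: "R = (\<Sum>i\<in>I. c i *\<^sub>C T i)"
  shows "conv_adjoint R \<phi> = (\<Sum>i\<in>I. c i *\<^sub>C conv_adjoint (T i) \<phi>)"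
proof (rule schwartz_eqI)
  fix x
  have "schwartz_fun (conv_adjoint R \<phi>) x = apply_dist R (reflect (translate (- x) (reflect
      \<phi>)))"
    by (simp add: conv_adjoint_def reflect.rep_eq convolver_fun R)
  also have "\<dots> = (\<Sum>i\<in>I. c i * apply_dist (T i) (reflect (translate (- x) (reflect
      \<phi>))))"
    by (simp add: eq)
  also have "\<dots> = schwartz_fun (\<Sum>i\<in>I. c i *\<^sub>C conv_adjoint (T i) \<phi>) x"
    by (simp add: schwartz_fun_sum schwartz_fun_scaleC conv_adjoint_def reflect.rep_eq convolver_fun T)
  finally show "schwartz_fun (conv_adjoint R \<phi>) x = schwartz_fun (\<Sum>i\<in>I. c i *\<^sub>C
      conv_adjoint (T i) \<phi>) x" .
qed

lemma conv_sum:
  fixes R :: "'n::finite tempered"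
  assumes R: "convolver R" and T: "\<And>i. i \<in> I \<Longrightarrow> convolver (T i)"
    and eq: "R = (\<Sum>i\<in>I. c i *\<^sub>C T i)"
  shows "conv R u = (\<Sum>i\<in>I. c i *\<^sub>C conv (T i) u)"
  by (rule tempered_eqI)
    (simp add: apply_dist_conv R T conv_adjoint_sum[OF R T eq] apply_dist_test_sum
        apply_dist_test_scaleC)

text \<open>The derivatives move from the Dirac distribution, the unit of convolution, onto u. This
  turns the generating distribution into the differential operator.\<close>

lemma conv_diff_op_dirac:
  assumes "convolver (diff_op p dirac)"
  shows "conv (diff_op p dirac) u = diff_op p u"
proof -
  have "conv dirac u = u"
    by (rule tempered_eqI) (simp add: apply_dist_conv convolver_dirac)
  moreover have "conv (diff_op p dirac) u = (\<Sum>\<alpha>\<in>Poly_Mapping.keys p.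
      Poly_Mapping.lookup p \<alpha> *\<^sub>C conv (mi_power tempered_partial \<alpha> dirac) u)"
    by (rule conv_sum[OF assms _ diff_op_def]) (use conv_mi_power[OF convolver_dirac(1)] in blast)
  ultimately show ?thesis
    by (simp add: diff_op_def conv_mi_power[OF convolver_dirac(1)])
qed

lemma conv_zero:
  fixes u :: "'a::finite tempered"
  shows "convolver (0 :: 'a tempered)" "conv 0 u = 0"
proof -
  have eq: "schwartz_fun ((\<lambda>\<phi>. 0) \<phi>) x = apply_dist 0 (reflect (translate x
      \<phi>))" for x and \<phi> :: "'a schwartz"
    by (simp add: schwartz_fun_zero)
  have op: "(\<lambda>\<phi>::'a schwartz. 0 :: 'a schwartz) \<in> schwartz_operators"
    using scaleC_schwartz.rep_eq by (auto simp: schwartz_operators_def intro: schwartz_eqI simp: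
        schwartz_fun_scaleC schwartz_fun_zero)
  show c: "convolver (0 :: 'a tempered)"
    by (rule convolverI(1)[OF op eq])
  show "conv 0 u = 0"
    \<comment> \<open>The zero distribution is an empty sum, so its adjoint vanishes.\<close>
    using conv_adjoint_sum[OF c, of "{}" "\<lambda>_. 0" "\<lambda>_. 0"]
    by (intro tempered_eqI) (simp add: apply_dist_conv[OF c] apply_dist_test_zero)
qed

section \<open>Differentiating the semigroup weakly\<close>

text \<open>Links \<open>has_derivative_in\<close>, stated with difference quotients, to the
  calculus of \<open>has_vector_derivative\<close> for scalar functions.\<close>

lemma has_vector_derivative_iff_quotient:
  "(f has_vector_derivative D) (at t within A) \<longleftrightarrow>
    ((\<lambda>s. (1 / (s - t)) *\<^sub>R (f s - f t)) \<longlongrightarrow> D) (at t within A)"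
proof -
  have "(f has_vector_derivative D) (at t within A) \<longleftrightarrow>
      ((\<lambda>s. norm (f s - f t - (s - t) *\<^sub>R D) / norm (s - t)) \<longlongrightarrow> 0)
          (at t within A)"
    by (simp add: has_vector_derivative_def has_derivative_iff_norm bounded_linear_scaleR_left)
  also have "\<dots> \<longleftrightarrow> ((\<lambda>s. norm ((1 / (s - t)) *\<^sub>R (f s - f t)
      - D)) \<longlongrightarrow> 0) (at t within A)"
  proof (rule filterlim_cong[OF refl refl])
    have "norm (f s - f t - (s - t) *\<^sub>R D) / norm (s - t) = norm ((1 / (s - t)) *\<^sub>R (f
        s - f t) - D)"
      if "s \<noteq> t" for s
    proof -
      have "(1 / (s - t)) *\<^sub>R (f s - f t - (s - t) *\<^sub>R D) = (1 / (s - t)) *\<^sub>R (f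
          s - f t) - D"
        using that by (simp add: scaleR_diff_right)
      from arg_cong[OF this, of norm] show ?thesis
        by (simp add: divide_inverse mult.commute)
    qed
    then show "\<forall>\<^sub>F s in at t within A. norm (f s - f t - (s - t) *\<^sub>R D) / norm
        (s - t)
        = norm ((1 / (s - t)) *\<^sub>R (f s - f t) - D)"
      by (auto simp: eventually_at_filter)
  qed
  also have "\<dots> \<longleftrightarrow> ((\<lambda>s. (1 / (s - t)) *\<^sub>R (f s - f t))
      \<longlongrightarrow> D) (at t within A)"
    by (simp add: tendsto_norm_zero_iff LIM_zero_iff)
  finally show ?thesis .
qed

lemma continuous_map_vec_nth: "continuous_map (vec_topology X) X (\<lambda>v. v $ i)"
  using continuous_map_pullback[OF continuous_map_product_projection[of i UNIV "\<lambda>_. X"]]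
  by (simp add: vec_topology_def o_def)

lemma limitin_vec_nth:
  "limitin (vec_topology X) f l F \<Longrightarrow> limitin X (\<lambda>x. f x $ i) (l $ i) F"
  using continuous_map_limit[OF continuous_map_vec_nth] by (fastforce simp: o_def)

lemma topspace_vec_nth:
  assumes "v \<in> topspace (vec_topology X)"
  shows "v $ i \<in> topspace X"
proof -
  have "(\<lambda>v. v $ i) ` topspace (vec_topology X) \<subseteq> topspace X"
    by (rule continuous_map_image_subset_topspace[OF continuous_map_vec_nth])
  then show ?thesis
    using assms by auto
qed

lemma apply_conv_vec:
  assumes "\<And>j. convolver (A $ i $ j)"
  shows "apply_dist (conv_vec A u $ i) \<phi> = (\<Sum>j\<in>UNIV. apply_dist (u $ j) (conv_adjoint
      (A $ i $ j) \<phi>))"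
  by (simp add: conv_vec_def apply_dist_conv assms)

text \<open>The difference is written as a sum over \<open>bool\<close> so that
  \<open>conv_adjoint_sum\<close> applies.\<close>

lemma conv_adjoint_quotient:
  assumes Q: "convolver (r *\<^sub>R (A - B))" and A: "convolver A" and B: "convolver B"
  shows "conv_adjoint (r *\<^sub>R (A - B)) \<phi> = of_real r *\<^sub>C (conv_adjoint A \<phi> -
      conv_adjoint B \<phi>)"
proof -
  have "r *\<^sub>R (A - B) = (\<Sum>b\<in>UNIV. (if b then of_real r else - of_real r) *\<^sub>C
      (if b then A else B))"
    by (rule tempered_eqI) (simp add: UNIV_bool algebra_simps)
  from conv_adjoint_sum[OF Q _ this, of \<phi>] A B
  have "conv_adjoint (r *\<^sub>R (A - B)) \<phi> = of_real r *\<^sub>C conv_adjoint A \<phi> + (-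
      of_real r) *\<^sub>C conv_adjoint B \<phi>"
    by (simp add: UNIV_bool add.commute)
  then show ?thesis
    by (simp add: minus_schwartz_def uminus_schwartz_def scaleC_add_right scaleC_scaleC
        del: add_uminus_conv_diff)
qed

lemma continuous_map_conv_adjoint: "continuous_map OC_topology schwartz_topology (\<lambda>T.
    conv_adjoint T \<phi>)"
  using continuous_map_compose[OF continuous_map_conv_test continuous_map_reflect]
  by (simp add: conv_adjoint_def o_def)

text \<open>The difference quotients of \<open>S\<close> converge in \<open>OC_topology\<close>;
  their adjoints at phi then converge in the Schwartz space, and each component of u is continuous
  there.\<close>

lemma has_vector_derivative_conv_vec:
  fixes S :: "real \<Rightarrow> 'n::finite tempered ^ 'm::finite ^ 'm"
  assumes D: "has_derivative_in OC_matrix_topology S D t" and t: "0 \<le> t"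
    and S: "\<And>s i j. 0 \<le> s \<Longrightarrow> convolver (S s $ i $ j)"
  shows "((\<lambda>s. apply_dist (conv_vec (S s) u $ i) \<phi>) has_vector_derivative
      apply_dist (conv_vec D u $ i) \<phi>) (at t within {0..})"
proof -
  let ?F = "at t within {0..}"
  define Q where "Q s = (1 / (s - t)) *\<^sub>R (S s - S t)" for s
  have lim: "limitin OC_topology (\<lambda>s. Q s $ i $ j) (D $ i $ j) ?F" for j
    using limitin_vec_nth[OF limitin_vec_nth[OF D[unfolded has_derivative_in_def]]] by (simp add: Q_def)
  have Dc: "convolver (D $ i $ j)" for j
    by (intro OC_topspace_convolver limitin_topspace[OF lim])
  \<comment> \<open>Convergence keeps the quotients eventually in the carrier. They are thus
    convolvers, and their adjoints are the quotients of the adjoints of \<open>S\<close>.\<close>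
  have Q_conv: "eventually (\<lambda>s. Q s $ i $ j \<in> topspace OC_topology) ?F" for j
    using lim[of j] openin_topspace[of OC_topology] unfolding limitin_def by blast
  have "((\<lambda>s. apply_dist (u $ j) (conv_adjoint (Q s $ i $ j) \<phi>)) \<longlongrightarrow>
      apply_dist (u $ j) (conv_adjoint (D $ i $ j) \<phi>)) ?F" for j
    using continuous_map_limit[OF continuous_map_compose[OF continuous_map_conv_adjoint
        apply_dist_continuous] lim]
    by (simp add: o_def)
  then have "((\<lambda>s. \<Sum>j\<in>UNIV. apply_dist (u $ j) (conv_adjoint (Q s $ i $ j)
      \<phi>)) \<longlongrightarrow> apply_dist (conv_vec D u $ i) \<phi>) ?F"
    unfolding apply_conv_vec[OF Dc] by (rule tendsto_sum)
  moreover have "eventually (\<lambda>s. (\<Sum>j\<in>UNIV. apply_dist (u $ j) (conv_adjoint (Q s $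
      i $ j) \<phi>))
      = (1 / (s - t)) *\<^sub>R (apply_dist (conv_vec (S s) u $ i) \<phi> - apply_dist (conv_vec (S
          t) u $ i) \<phi>)) ?F"
  proof -
    have "eventually (\<lambda>s. s \<in> {0..}) ?F"
      by (simp add: eventually_at_filter)
    moreover have "eventually (\<lambda>s. \<forall>j. Q s $ i $ j \<in> topspace OC_topology) ?F"
      using Q_conv by (intro eventually_all_finite) auto
    ultimately show ?thesis
    proof eventually_elim
      case (elim s)
      then have s: "0 \<le> s" by simp
      have "apply_dist (u $ j) (conv_adjoint (Q s $ i $ j) \<phi>) = (1 / (s - t)) *\<^sub>R
          (apply_dist (u $ j) (conv_adjoint (S s $ i $ j) \<phi>) - apply_dist (u $ j)
              (conv_adjoint (S t $ i $ j) \<phi>))" for j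
      proof -
        have "Q s $ i $ j = (1 / (s - t)) *\<^sub>R (S s $ i $ j - S t $ i $ j)"
          by (simp add: Q_def)
        moreover have "convolver (Q s $ i $ j)"
          using elim by (simp add: OC_topspace_convolver)
        ultimately show ?thesis
          using S[OF s, of i j] S[OF t, of i j]
          by (simp add: conv_adjoint_quotient apply_dist_test_scaleC apply_dist_test_diff
              scaleR_conv_of_real del: of_real_divide)
      qed
      then show ?case
        by (simp only: apply_conv_vec S s t flip: sum_subtractf scaleR_sum_right)
    qed
  qed
  ultimately show ?thesis
    unfolding has_vector_derivative_iff_quotient by (rule Lim_transform_eventually)
qed

section \<open>Generator and weak derivative of the semigroup\<close>

locale convolution_semigroup =
  fixes S :: "real \<Rightarrow> 'n::finite tempered ^ 'm::finite ^ 'm" and G :: "'n polynomial ^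
      'm ^ 'm"
  assumes idcs: "idcs S" and generator: "generating_distribution S (system_dirac G)"
begin

lemma continuous_map_S: "continuous_map (top_of_set {0..}) OC_matrix_topology S"
proof -
  obtain d where d: "\<forall>t\<ge>0. d 0 t = S t" "\<forall>j. enat j \<le> \<infinity>
      \<longrightarrow> continuous_map (top_of_set {0..}) OC_matrix_topology (d j)"
    using idcs unfolding idcs_def C_k_in_def by blast
  then have "continuous_map (top_of_set {0..}) OC_matrix_topology (d 0)"
    by simp
  then show ?thesis
    by (rule continuous_map_eq) (use d in auto)
qed

lemma continuous_map_S_nth: "continuous_map (top_of_set {0..}) OC_topology (\<lambda>t. S t $ i $ j)"
  using continuous_map_compose[OF continuous_map_compose[OF continuous_map_S continuous_map_vec_nth]
      continuous_map_vec_nth]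
  by (simp add: o_def)

lemma convolver_S: "0 \<le> t \<Longrightarrow> convolver (S t $ i $ j)"
  using continuous_map_image_subset_topspace[OF continuous_map_S_nth, of i j]
  by (auto intro: OC_topspace_convolver)

lemma differentiable_S:
  assumes "0 \<le> t"
  obtains D where "has_derivative_in OC_matrix_topology S D t"
proof -
  obtain d where d: "\<forall>t\<ge>0. d 0 t = S t"
      "\<forall>j. enat j < \<infinity> \<longrightarrow> (\<forall>t\<ge>0. has_derivative_in
          OC_matrix_topology (d j) (d (Suc j) t) t)"
    using idcs unfolding idcs_def C_k_in_def by blast
  have "has_derivative_in OC_matrix_topology (d 0) (d (Suc 0) t) t"
    using d(2) assms by simp
  then have "limitin OC_matrix_topology (\<lambda>s. (1 / (s - t)) *\<^sub>R (d 0 s - d 0 t)) (d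
      (Suc 0) t) (at t within {0..})"
    unfolding has_derivative_in_def .
  then have "has_derivative_in OC_matrix_topology S (d (Suc 0) t) t"
    unfolding has_derivative_in_def
    \<comment> \<open>\<open>d 0\<close> agrees with \<open>S\<close> only on the half-line, which
      suffices because the filter lives there.\<close>
    by (rule limitin_transform_eventually[rotated]) (use d assms in \<open>auto simp:
        eventually_at_filter\<close>)
  then show ?thesis
    by (rule that)
qed

lemma S_zero: "conv_vec (S 0) u = u"
proof -
  have "conv dirac u = u" for u :: "'n tempered"
    by (rule tempered_eqI) (simp add: apply_dist_conv convolver_dirac)
  moreover have "S 0 = identity_dirac"
    using idcs by (simp add: idcs_def)
  ultimately show ?thesis
    by (simp add: conv_vec_def identity_dirac_def vec_eq_iff conv_zero
        if_distrib[of "\<lambda>T. conv T _"] cong: if_cong)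
qed

text \<open>In the transposed semigroup law the adjoint of \<open>S s\<close>, the left factor, acts
  first.\<close>

lemma conv_adjoint_S_add:
  assumes "0 \<le> s" "0 \<le> t"
  shows "conv_adjoint (S (s + t) $ i $ k) \<phi> = (\<Sum>j\<in>UNIV. conv_adjoint (S t $ j $ k)
      (conv_adjoint (S s $ i $ j) \<phi>))"
proof -
  have "S (s + t) $ i $ k = (\<Sum>j\<in>UNIV. 1 *\<^sub>C conv (S s $ i $ j) (S t $ j $ k))"
    using idcs assms by (simp add: idcs_def conv_matrix_def scaleC_one)
  from conv_adjoint_sum[OF _ _ this, of \<phi>] assms show ?thesis
    by (simp add: convolver_S convolver_conv scaleC_one)
qed

text \<open>Associativity with an arbitrary tempered u is checked on test functions, where the two
  sides are the same double sum in different orders.\<close>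

lemma S_add:
  assumes "0 \<le> s" "0 \<le> t"
  shows "conv_vec (S (s + t)) u = conv_vec (S s) (conv_vec (S t) u)"
proof -
  have "apply_dist (conv_vec (S (s + t)) u $ i) \<phi> = apply_dist (conv_vec (S s) (conv_vec (S t)
      u) $ i) \<phi>" for i \<phi>
    using assms sum.swap[of "\<lambda>k j. apply_dist (u $ k) (conv_adjoint (S t $ j $ k)
        (conv_adjoint (S s $ i $ j) \<phi>))" UNIV UNIV]
    by (simp add: apply_conv_vec convolver_S conv_adjoint_S_add apply_dist_test_sum)
  then show ?thesis
    by (simp add: vec_eq_iff tempered_eqI)
qed

text \<open>As a limit, the generating distribution lies in the carrier of
  \<open>OC_matrix_topology\<close>, so its entries are convolvers and
  \<open>conv_diff_op_dirac\<close> applies entrywise.\<close>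

lemma conv_vec_system_dirac: "conv_vec (system_dirac G) u = apply_system G u"
proof -
  have "system_dirac G \<in> topspace OC_matrix_topology"
    using generator by (simp add: generating_distribution_def has_derivative_in_def limitin_def)
  then have "convolver (system_dirac G $ i $ j)" for i j
    by (intro OC_topspace_convolver topspace_vec_nth)
  then have "convolver (diff_op (G $ i $ j) dirac)" for i j
    by (simp add: system_dirac_def)
  then show ?thesis
    by (simp add: conv_vec_def apply_system_def system_dirac_def conv_diff_op_dirac)
qed

lemma derivative_at_zero:
  "((\<lambda>s. apply_dist (conv_vec (S s) u $ i) \<phi>) has_vector_derivative
      apply_dist (apply_system G u $ i) \<phi>) (at 0 within {0..})"
  using has_vector_derivative_conv_vec[OF generator[unfolded generating_distribution_def], of u i
      \<phi>]
  by (simp add: convolver_S conv_vec_system_dirac)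

text \<open>Keeps \<open>S t\<close> as the outer factor: transposed onto phi it only replaces phi
  by fixed test functions, against which the orbit of u is differentiated at 0. In
  \<open>derivative_at_zero_right\<close> the orbit of \<open>conv_vec (S t) u\<close> is
  differentiated instead.\<close>

lemma derivative_at_zero_left:
  assumes "0 \<le> t"
  shows "((\<lambda>s. apply_dist (conv_vec (S (t + s)) u $ i) \<phi>) has_vector_derivative
      apply_dist (conv_vec (S t) (apply_system G u) $ i) \<phi>) (at 0 within {0..})"
proof -
  have "((\<lambda>s. \<Sum>j\<in>UNIV. apply_dist (conv_vec (S s) u $ j) (conv_adjoint (S t $ i $
      j) \<phi>)) has_vector_derivative
      (\<Sum>j\<in>UNIV. apply_dist (apply_system G u $ j) (conv_adjoint (S t $ i $ j) \<phi>)))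
          (at 0 within {0..})"
    by (intro has_vector_derivative_sum derivative_at_zero)
  then have "((\<lambda>s. apply_dist (conv_vec (S t) (conv_vec (S s) u) $ i) \<phi>)
      has_vector_derivative
      apply_dist (conv_vec (S t) (apply_system G u) $ i) \<phi>) (at 0 within {0..})"
    by (simp add: apply_conv_vec[of "S t"] convolver_S assms)
  then show ?thesis
    by (rule has_vector_derivative_transform[rotated 2]) (use assms in \<open>auto simp: S_add\<close>)
qed

lemma derivative_at_zero_right:
  assumes "0 \<le> t"
  shows "((\<lambda>s. apply_dist (conv_vec (S (t + s)) u $ i) \<phi>) has_vector_derivative
      apply_dist (apply_system G (conv_vec (S t) u) $ i) \<phi>) (at 0 within {0..})"
  using derivative_at_zero[of "conv_vec (S t) u" i \<phi>]
  by (rule has_vector_derivative_transform[rotated 2]) (use assms in \<open>auto simp: S_add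
      add.commute[of t]\<close>)

lemma at_zero_within_nontrivial: "at (0::real) within {0..} \<noteq> bot"
proof -
  have "{0..} - {0} = {0::real<..}"
    by auto
  then show ?thesis
    by (simp add: at_within_eq_bot_iff)
qed

text \<open>Both expressions are the right derivative of the same scalar function, and such a
  derivative is unique.\<close>

lemma apply_system_conv_vec:
  assumes "0 \<le> t"
  shows "apply_system G (conv_vec (S t) u) = conv_vec (S t) (apply_system G u)"
  using vector_derivative_unique_within[OF at_zero_within_nontrivial
      derivative_at_zero_right[OF assms] derivative_at_zero_left[OF assms]]
  by (simp add: vec_eq_iff tempered_eqI)

text \<open>Differentiability of \<open>S\<close> at t yields existence of the derivative from both
  sides when t > 0. Its value can then be computed from the right alone, where the semigroup law
  reduces it to time 0.\<close>

lemma derivative_S: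
  assumes t: "0 \<le> t"
  shows "((\<lambda>s. apply_dist (conv_vec (S s) u $ i) \<phi>) has_vector_derivative
      apply_dist (conv_vec (S t) (apply_system G u) $ i) \<phi>) (at t within {0..})"
proof -
  obtain D where D: "has_derivative_in OC_matrix_topology S D t"
    using differentiable_S[OF t] .
  let ?f = "\<lambda>s. apply_dist (conv_vec (S s) u $ i) \<phi>"
  have f: "(?f has_vector_derivative apply_dist (conv_vec D u $ i) \<phi>) (at t within {0..})"
    by (rule has_vector_derivative_conv_vec[OF D t convolver_S])
  have "((\<lambda>s. t + s) has_vector_derivative 1) (at 0 within {0..})"
    by (auto intro!: derivative_eq_intros)
  moreover have "(?f has_vector_derivative apply_dist (conv_vec D u $ i) \<phi>) (at (t + 0) within
      (\<lambda>s. t + s) ` {0..})"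
    using has_vector_derivative_within_subset[OF f, of "(\<lambda>s. t + s) ` {0..}"] t by auto
  ultimately have "((\<lambda>s. ?f (t + s)) has_vector_derivative apply_dist (conv_vec D u $ i)
      \<phi>) (at 0 within {0..})"
    using vector_diff_chain_within[of "\<lambda>s. t + s" 1 0 "{0..}" ?f "apply_dist (conv_vec D u
        $ i) \<phi>"]
    by (simp add: o_def)
  from vector_derivative_unique_within[OF at_zero_within_nontrivial this derivative_at_zero_left[OF t]]
  show ?thesis
    using f by simp
qed

end

section \<open>Uniqueness\<close>

text \<open>The generating balls have arbitrary centres, so the proof is an induction over the
  generated open sets. A ball of radius e about z that contains l also contains the ball of radius
  \<open>e - p (l - z)\<close> about l.\<close>

lemma limitin_seminorm_topologyI:
  assumes "P \<noteq> {}" and triangle: "\<And>p x y. p \<in> P \<Longrightarrow> p (x + y) \<le> p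
      x + p y"
    and lim: "\<And>p e. p \<in> P \<Longrightarrow> 0 < e \<Longrightarrow> eventually
        (\<lambda>x. p (f x - l) < e) F"
  shows "limitin (seminorm_topology P) f l F"
  unfolding limitin_def
proof (intro conjI allI impI)
  show "l \<in> topspace (seminorm_topology P)"
    by (simp add: assms(1))
  fix U assume "openin (seminorm_topology P) U \<and> l \<in> U"
  then have "generate_topology_on {{y. p (y - x) < e} | p x e. p \<in> P \<and> 0 < e} U" "l \<in> U"
    by (auto simp: seminorm_topology_def openin_topology_generated_by_iff)
  then show "\<forall>\<^sub>F x in F. f x \<in> U"
  proof induction
    case (Int a b)
    then have "eventually (\<lambda>x. f x \<in> a) F" "eventually (\<lambda>x. f x \<in> b) F"
      by blast+
    then show ?case
      by eventually_elim simp
  next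
    case (UN K)
    then obtain k where "k \<in> K" "l \<in> k" by blast
    then have "eventually (\<lambda>x. f x \<in> k) F"
      by (rule UN.IH)
    then show ?case
      by (rule eventually_mono) (use \<open>k \<in> K\<close> in blast)
  next
    case (Basis s)
    then obtain p z e where p: "p \<in> P" and s: "s = {y. p (y - z) < e}"
      by blast
    have "0 < e - p (l - z)"
      using Basis by (simp add: s)
    from lim[OF p this] show ?case
    proof (rule eventually_mono)
      fix x assume "p (f x - l) < e - p (l - z)"
      then show "f x \<in> s"
        using triangle[OF p, of "f x - l" "l - z"] by (simp add: s)
    qed
  qed simp
qed

section \<open>Bounded sets of test functions and strong limits\<close>

lemma schwartz_seminorm_scaleC_le:
  "schwartz_seminorm N ks (c *\<^sub>C \<phi>) \<le> cmod c * schwartz_seminorm N ks \<phi>"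
  unfolding schwartz_seminorm_def[of N ks "c *\<^sub>C \<phi>"]
proof (rule cSUP_least)
  fix x
  have "partials ks (schwartz_fun (c *\<^sub>C \<phi>)) x = c * partials ks (schwartz_fun \<phi>) x"
    using schwartz_fun[of \<phi>] by (simp add: scaleC_schwartz.rep_eq partials_cmult)
  then have "(1 + norm x) ^ N * cmod (partials ks (schwartz_fun (c *\<^sub>C \<phi>)) x)
      = cmod c * ((1 + norm x) ^ N * cmod (partials ks (schwartz_fun \<phi>) x))"
    by (simp add: norm_mult)
  also have "\<dots> \<le> cmod c * schwartz_seminorm N ks \<phi>"
    by (intro mult_left_mono schwartz_seminorm_upper) simp
  finally show "(1 + norm x) ^ N * cmod (partials ks (schwartz_fun (c *\<^sub>C \<phi>)) x)
      \<le> cmod c * schwartz_seminorm N ks \<phi>" .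
qed simp

lemma schwartz_seminorm_diff_bound:
  "\<bar>schwartz_seminorm N ks \<phi> - schwartz_seminorm N ks \<psi>\<bar> \<le>
      schwartz_seminorm N ks (\<phi> - \<psi>)"
proof -
  have "(- 1) *\<^sub>C (\<phi> - \<psi>) = \<psi> - \<phi>"
    by (metis minus_diff_eq uminus_schwartz_def)
  then have "schwartz_seminorm N ks (\<psi> - \<phi>) \<le> schwartz_seminorm N ks (\<phi> - \<psi>)"
    using schwartz_seminorm_scaleC_le[of N ks "- 1" "\<phi> - \<psi>"] by simp
  then show ?thesis
    using schwartz_seminorm_triangle[of N ks "\<phi> - \<psi>" \<psi>]
        schwartz_seminorm_triangle[of N ks "\<psi> - \<phi>" \<phi>]
    by simp
qed

lemma continuous_map_schwartz_seminorm:
  "continuous_map schwartz_topology euclidean (schwartz_seminorm N ks)"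
  unfolding continuous_map_def
proof (intro conjI allI impI)
  fix U :: "real set"
  assume "openin euclidean U"
  then have U: "open U" by simp
  show "openin schwartz_topology {\<phi> \<in> topspace schwartz_topology. schwartz_seminorm N ks
      \<phi> \<in> U}"
  proof (subst openin_subopen, intro ballI)
    fix \<phi> assume "\<phi> \<in> {\<phi> \<in> topspace schwartz_topology. schwartz_seminorm N
        ks \<phi> \<in> U}"
    then obtain e where e: "0 < e" "\<And>z. \<bar>z - schwartz_seminorm N ks \<phi>\<bar> < e
        \<Longrightarrow> z \<in> U"
      using U unfolding open_dist dist_real_def by blast
    have "schwartz_seminorm N ks \<psi> \<in> U" if "schwartz_seminorm N ks (\<psi> - \<phi>) < e"
        for \<psi>
      using that schwartz_seminorm_diff_bound[of N ks \<psi> \<phi>] by (intro e(2)) simp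
    then show "\<exists>T. openin schwartz_topology T \<and> \<phi> \<in> T \<and>
        T \<subseteq> {\<phi> \<in> topspace schwartz_topology. schwartz_seminorm N ks \<phi> \<in> U}"
      using openin_schwartz_ball[OF e(1), of N ks \<phi>] e(1)
      by (intro exI[of _ "{\<psi>. schwartz_seminorm N ks (\<psi> - \<phi>) < e}"]) auto
  qed
qed simp

text \<open>Otherwise some phi_n in \<open>B\<close> have values of modulus above n + 1; divided by
  n + 1 they tend to 0 in the Schwartz space while the values of \<open>T\<close> stay above 1. This
  makes the supremum in \<open>strong_seminorm\<close> a genuine one.\<close>

lemma tempered_bounded_on_bounded:
  assumes B: "schwartz_bounded B"
  shows "bdd_above ((\<lambda>\<phi>. cmod (apply_dist T \<phi>)) ` B)"
proof (rule ccontr)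
  assume "\<not> bdd_above ((\<lambda>\<phi>. cmod (apply_dist T \<phi>)) ` B)"
  then have "\<exists>\<phi>\<in>B. real (Suc n) < cmod (apply_dist T \<phi>)" for n
    unfolding bdd_above_def by (metis (no_types, lifting) imageE linorder_not_le)
  then obtain \<phi> where \<phi>: "\<And>n. \<phi> n \<in> B" "\<And>n. real (Suc n) < cmod
      (apply_dist T (\<phi> n))"
    by metis
  define \<psi> where "\<psi> n = (1 / of_nat (Suc n) :: complex) *\<^sub>C \<phi> n" for n
  have "limitin (seminorm_topology {schwartz_seminorm N ks | N (ks :: 'a list). True}) \<psi> 0
      sequentially"
  proof (rule limitin_seminorm_topologyI)
    fix p :: "'a schwartz \<Rightarrow> real" and e :: real
    assume "p \<in> {schwartz_seminorm N ks |N ks. True}" and e: "0 < e"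
    then obtain N ks where p: "p = schwartz_seminorm N ks"
      by blast
    obtain C where C: "\<And>\<phi>. \<phi> \<in> B \<Longrightarrow> schwartz_seminorm N ks \<phi>
        \<le> C"
      using B unfolding schwartz_bounded_def bdd_above_def by blast
    have "(\<lambda>n. C * (1 / real (Suc n))) \<longlonglongrightarrow> C * 0"
      by (intro tendsto_mult_left LIMSEQ_Suc[OF lim_1_over_n])
    then have "eventually (\<lambda>n. C * (1 / real (Suc n)) < e) sequentially"
      using e by (simp add: order_tendstoD(2))
    then show "eventually (\<lambda>n. p (\<psi> n - 0) < e) sequentially"
    proof (rule eventually_mono)
      fix n assume n: "C * (1 / real (Suc n)) < e"
      have "p (\<psi> n) \<le> cmod (1 / of_nat (Suc n)) * schwartz_seminorm N ks (\<phi> n)"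
        unfolding p \<psi>_def by (rule schwartz_seminorm_scaleC_le)
      also have "\<dots> \<le> (1 / real (Suc n)) * C"
        using C[OF \<phi>(1)[of n]] by (intro mult_mono) (auto simp: norm_divide simp del: of_nat_Suc
            intro!: order_trans[OF _ schwartz_seminorm_upper])
      finally show "p (\<psi> n - 0) < e"
        using n by (simp add: mult.commute)
    qed
  qed (use schwartz_seminorm_triangle in auto)
  then have "limitin schwartz_topology \<psi> 0 sequentially"
    unfolding schwartz_topology_def .
  from continuous_map_limit[OF apply_dist_continuous this, of T]
  have "(\<lambda>n. apply_dist T (\<psi> n)) \<longlonglongrightarrow> 0"
    by (simp add: o_def apply_dist_test_zero)
  then have "eventually (\<lambda>n. cmod (apply_dist T (\<psi> n)) < 1) sequentially"
    by (rule order_tendstoD(2)[OF tendsto_norm_zero]) simp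
  then obtain n where "cmod (apply_dist T (\<psi> n)) < 1"
    by (auto simp: eventually_sequentially)
  then have "cmod (apply_dist T (\<phi> n)) < real (Suc n)"
    by (simp add: \<psi>_def apply_dist_test_scaleC norm_divide norm_mult divide_simps del: of_nat_Suc)
  then show False
    using \<phi>(2)[of n] by simp
qed

lemma strong_limit_uniform:
  assumes lim: "limitin strong_dual_topology T l F"
    and B: "B \<noteq> {}" "schwartz_bounded B" and e: "0 < e"
  shows "eventually (\<lambda>x. \<forall>\<phi>\<in>B. cmod (apply_dist (T x) \<phi> - apply_dist
      l \<phi>) < e) F"
proof -
  let ?U = "{y. strong_seminorm B (y - l) < e}"
  have "openin strong_dual_topology ?U"
    unfolding strong_dual_topology_def using B e by (intro openin_seminorm_ball) auto
  moreover have "l \<in> ?U"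
    using B(1) e by (simp add: strong_seminorm_def)
  ultimately have "eventually (\<lambda>x. T x \<in> ?U) F"
    by (rule limitinD[OF lim])
  then show ?thesis
  proof (rule eventually_mono, intro ballI)
    fix x \<phi> assume x: "T x \<in> ?U" and \<phi>: "\<phi> \<in> B"
    have "cmod (apply_dist (T x - l) \<phi>) \<le> strong_seminorm B (T x - l)"
      unfolding strong_seminorm_def by (rule cSUP_upper[OF \<phi> tempered_bounded_on_bounded[OF B(2)]])
    then show "cmod (apply_dist (T x) \<phi> - apply_dist l \<phi>) < e"
      using x by simp
  qed
qed

lemma strong_limit_weak:
  assumes "limitin strong_dual_topology T l F"
  shows "((\<lambda>x. apply_dist (T x) \<phi>) \<longlongrightarrow> apply_dist l \<phi>) F"
proof (rule tendstoI)
  fix e :: real assume "0 < e"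
  moreover have "schwartz_bounded {\<phi>}"
    by (simp add: schwartz_bounded_def)
  ultimately show "eventually (\<lambda>x. dist (apply_dist (T x) \<phi>) (apply_dist l \<phi>) < e) F"
    using strong_limit_uniform[OF assms, of "{\<phi>}" e] by (simp add: dist_norm)
qed

context convolution_semigroup
begin

lemma continuous_map_conv_adjoint_S:
  "continuous_map (top_of_set {0..}) schwartz_topology (\<lambda>\<tau>. conv_adjoint (S \<tau> $ i
      $ j) \<phi>)"
  using continuous_map_compose[OF continuous_map_S_nth continuous_map_conv_adjoint] by (simp add: o_def)

text \<open>Seminorms are continuous along the adjoint orbit and the time interval is compact. On
  this bounded set strong convergence becomes uniform.\<close>

lemma conv_adjoint_S_bounded: "schwartz_bounded ((\<lambda>\<tau>. conv_adjoint (S \<tau> $ i $ j)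
    \<phi>) ` {0..t})"
  unfolding schwartz_bounded_def
proof (intro allI)
  fix N and ks :: "'n list"
  have "continuous_on {0..} (\<lambda>\<tau>. schwartz_seminorm N ks (conv_adjoint (S \<tau> $ i $
      j) \<phi>))"
    using continuous_map_compose[OF continuous_map_conv_adjoint_S continuous_map_schwartz_seminorm]
    by (simp add: o_def)
  then have "compact ((\<lambda>\<tau>. schwartz_seminorm N ks (conv_adjoint (S \<tau> $ i $ j)
      \<phi>)) ` {0..t})"
    by (intro compact_continuous_image) (auto intro: continuous_on_subset)
  then show "bdd_above (schwartz_seminorm N ks ` (\<lambda>\<tau>. conv_adjoint (S \<tau> $ i $ j)
      \<phi>) ` {0..t})"
    unfolding image_image by (intro bounded_imp_bdd_above compact_imp_bounded)
qed

lemma cauchy_solution_unique: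
  assumes v: "solves_cauchy_in tempered_vec_topology G u\<^sub>0 v" and t: "0 \<le> t"
  shows "v t = conv_vec (S t) u\<^sub>0"
proof (cases "t = 0")
  case True
  then show ?thesis
    using v by (simp add: solves_cauchy_in_def S_zero)
next
  case False
  with t have t: "0 < t" by simp
  have "apply_dist (v t $ i) \<phi> = apply_dist (conv_vec (S t) u\<^sub>0 $ i) \<phi>" for i \<phi>
  proof -
    \<comment> \<open>The test function is transported backwards: \<open>f\<close> pairs v(r) with
      the adjoint of S at time t - r. Its value at r = t is v(t) tested on phi, and at r = 0 it is
      S_t * u_0 tested on phi.\<close>
    define A where "A j r = conv_adjoint (S (t - r) $ i $ j) \<phi>" for j r
    define f where "f r = (\<Sum>j\<in>UNIV. apply_dist (v r $ j) (A j r))" for r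
    have f_eq: "(\<Sum>j\<in>UNIV. apply_dist (w $ j) (A j r)) = apply_dist (conv_vec (S (t - r)) w
        $ i) \<phi>"
      if "r \<le> t" for w r
      using that by (simp add: A_def apply_conv_vec convolver_S)
    have deriv: "(f has_vector_derivative 0) (at s within {0..t})" if s: "s \<in> {0..t}" for s
    proof -
      let ?F = "at s within {0..t}"
      define g where "g = apply_system G (v s)"
      define q where "q r = (1 / (r - s)) *\<^sub>R (v r - v s)" for r
      have F: "?F \<le> at s within {0..}"
        by (rule at_le) auto
      have near: "eventually (\<lambda>r. r \<in> {0..t}) ?F"
        by (simp add: eventually_at_filter)
      have q: "limitin strong_dual_topology (\<lambda>r. q r $ j) (g $ j) (at s within {0..})" for j
        using v s limitin_vec_nth[of strong_dual_topology q g "at s within {0..}" j]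
        by (simp add: solves_cauchy_in_def has_derivative_in_def q_def[abs_def] g_def)
      \<comment> \<open>Here distribution and test function vary together. The test functions stay
        in a bounded set, so the quotients may be replaced by their limit \<open>g j\<close>
        uniformly; continuity of the orbit handles the rest.\<close>
      have lim1: "((\<lambda>r. apply_dist (q r $ j) (A j r)) \<longlongrightarrow> apply_dist (g $
          j) (A j s)) ?F" for j
      proof -
        have "((\<lambda>r. apply_dist (q r $ j) (A j r) - apply_dist (g $ j) (A j r))
            \<longlongrightarrow> 0) ?F"
        proof (rule tendstoI)
          fix e :: real assume e: "0 < e"
          let ?B = "(\<lambda>\<tau>. conv_adjoint (S \<tau> $ i $ j) \<phi>) ` {0..t}"
          have "eventually (\<lambda>r. \<forall>\<psi>\<in>?B. cmod (apply_dist (q r $ j) \<psi> -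
              apply_dist (g $ j) \<psi>) < e) (at s within {0..})"
            by (rule strong_limit_uniform[OF q _ conv_adjoint_S_bounded e]) (use t in auto)
          from near filter_leD[OF F this]
          show "eventually (\<lambda>r. dist (apply_dist (q r $ j) (A j r) - apply_dist (g $ j) (A
              j r)) 0 < e) ?F"
            by eventually_elim (simp add: A_def)
        qed
        moreover have "((\<lambda>r. apply_dist (g $ j) (A j r)) \<longlongrightarrow> apply_dist
            (g $ j) (A j s)) ?F"
        proof -
          have "continuous_on {0..} (\<lambda>\<tau>. apply_dist (g $ j) (conv_adjoint (S \<tau> $
              i $ j) \<phi>))"
            using continuous_map_compose[OF continuous_map_conv_adjoint_S apply_dist_continuous] by
                (simp add: o_def)
          then have "continuous_on {0..t} (\<lambda>r. apply_dist (g $ j) (A j r))"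
            unfolding A_def by (rule continuous_on_compose2) (auto intro!: continuous_intros)
          then show ?thesis
            using s by (simp add: continuous_on_def)
        qed
        ultimately show ?thesis
          using tendsto_add by fastforce
      qed
      \<comment> \<open>With v frozen at time s only the semigroup varies; reversing time produces
        the minus sign.\<close>
      have "((\<lambda>r. \<Sum>j\<in>UNIV. apply_dist (v s $ j) (A j r)) has_vector_derivative
          - (\<Sum>j\<in>UNIV. apply_dist (g $ j) (A j s))) ?F"
      proof -
        have "((\<lambda>r. t - r) has_vector_derivative - 1) ?F"
          by (auto intro!: derivative_eq_intros)
        moreover have "((\<lambda>\<tau>. apply_dist (conv_vec (S \<tau>) (v s) $ i) \<phi>)
            has_vector_derivative
            apply_dist (conv_vec (S (t - s)) g $ i) \<phi>) (at (t - s) within (\<lambda>r. t - r)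
                ` {0..t})"
          unfolding g_def by (rule has_vector_derivative_within_subset[OF derivative_S]) (use s in auto)
        ultimately have "((\<lambda>r. apply_dist (conv_vec (S (t - r)) (v s) $ i) \<phi>)
            has_vector_derivative
            - apply_dist (conv_vec (S (t - s)) g $ i) \<phi>) ?F"
          using vector_diff_chain_within[of "\<lambda>r. t - r" "- 1" s "{0..t}"] by (fastforce
              simp: o_def)
        then show ?thesis
          by (rule has_vector_derivative_transform[rotated 2, THEN has_vector_derivative_eq_rhs])
            (use s f_eq in auto)
      qed
      then have lim2: "((\<lambda>r. (1 / (r - s)) *\<^sub>R ((\<Sum>j\<in>UNIV. apply_dist (v s $
          j) (A j r))
          - (\<Sum>j\<in>UNIV. apply_dist (v s $ j) (A j s)))) \<longlongrightarrow> -
              (\<Sum>j\<in>UNIV. apply_dist (g $ j) (A j s))) ?F"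
        by (simp add: has_vector_derivative_iff_quotient)
      have "((\<lambda>r. (\<Sum>j\<in>UNIV. apply_dist (q r $ j) (A j r)) + (1 / (r - s))
          *\<^sub>R ((\<Sum>j\<in>UNIV. apply_dist (v s $ j) (A j r))
          - (\<Sum>j\<in>UNIV. apply_dist (v s $ j) (A j s)))) \<longlongrightarrow>
              (\<Sum>j\<in>UNIV. apply_dist (g $ j) (A j s))
            + - (\<Sum>j\<in>UNIV. apply_dist (g $ j) (A j s))) ?F"
        by (intro tendsto_add tendsto_sum lim1 lim2)
      moreover have "(\<Sum>j\<in>UNIV. apply_dist (q r $ j) (A j r)) + (1 / (r - s)) *\<^sub>R
          ((\<Sum>j\<in>UNIV. apply_dist (v s $ j) (A j r))
          - (\<Sum>j\<in>UNIV. apply_dist (v s $ j) (A j s))) = (1 / (r - s)) *\<^sub>R (f r - f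
              s)" for r
      proof -
        define c where "c = 1 / (r - s)"
        show ?thesis
          unfolding q_def f_def c_def[symmetric]
          by (simp add: sum_subtractf scaleR_conv_of_real algebra_simps flip: sum_distrib_left)
      qed
      ultimately show ?thesis
        by (simp add: has_vector_derivative_iff_quotient)
    qed
    obtain c where "\<And>r. r \<in> {0..t} \<Longrightarrow> f r = c"
      by (rule has_vector_derivative_zero_constant[OF _ deriv]) auto
    then have "f t = f 0"
      using t by simp
    moreover have "f t = apply_dist (v t $ i) \<phi>"
      using f_eq[of t "v t"] by (simp add: f_def S_zero)
    moreover have "f 0 = apply_dist (conv_vec (S t) u\<^sub>0 $ i) \<phi>"
      using f_eq[of 0 "v 0"] v t by (simp add: f_def solves_cauchy_in_def)
    ultimately show ?thesis
      by simp
  qed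
  then show ?thesis
    by (simp add: vec_eq_iff tempered_eqI)
qed

end

section \<open>Riemann sums in sequentially complete spaces\<close>

lemma scaleC_minus_one: "(- 1) *\<^sub>C x = - (x :: 'a::complex_vector)"
  using scaleR_scaleC[of "- 1" x] by simp

locale seq_complete_lcs =
  fixes X :: "'a::complex_vector topology"
  assumes lcs: "locally_convex_space X" and complete: "sequentially_complete X"
begin

lemma subspace_carrier: "subspace (topspace X)"
  using lcs unfolding locally_convex_space_def complex_subspace_def subspace_def
  by (simp add: scaleR_scaleC)

lemma continuous_map_add_const:
  assumes "l \<in> topspace X"
  shows "continuous_map X X (\<lambda>x. l + x)"
proof -
  have "continuous_map X (prod_topology X X) (\<lambda>x. (l, x))"
    using assms by (intro continuous_map_pairedI) auto
  moreover have "continuous_map (prod_topology X X) X (\<lambda>(x, y). x + y)"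
    using lcs by (simp add: locally_convex_space_def)
  ultimately show ?thesis
    using continuous_map_compose by (fastforce simp: o_def)
qed

lemma continuous_map_uminus: "continuous_map X X (\<lambda>x. - x)"
proof -
  have "continuous_map X (prod_topology euclidean X) (\<lambda>x. (- 1 :: complex, x))"
    by (intro continuous_map_pairedI) auto
  moreover have "continuous_map (prod_topology euclidean X) X (\<lambda>(c, x). c *\<^sub>C x)"
    using lcs by (simp add: locally_convex_space_def)
  ultimately have "continuous_map X X ((\<lambda>(c, x). c *\<^sub>C x) \<circ> (\<lambda>x. (- 1
      :: complex, x)))"
    by (rule continuous_map_compose)
  then show ?thesis
    by (simp add: o_def scaleC_minus_one)
qed

lemma openin_diff_right:
  assumes "openin X V" "l \<in> topspace X"
  shows "openin X {x \<in> topspace X. x - l \<in> V}"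
proof -
  have "- l \<in> topspace X"
    using assms(2) subspace_carrier by (rule subspace_neg[rotated])
  from openin_continuous_map_preimage[OF continuous_map_add_const[OF this] assms(1)]
  show ?thesis by simp
qed

lemma openin_diff_left:
  assumes "openin X V" "l \<in> topspace X"
  shows "openin X {x \<in> topspace X. l - x \<in> V}"
  using openin_continuous_map_preimage[OF continuous_map_compose[OF continuous_map_uminus
      continuous_map_add_const[OF assms(2)]] assms(1)]
  by (simp add: o_def)

text \<open>Continuity of addition at (0, 0) gives neighbourhoods \<open>A\<close> and
  \<open>B\<close> with sums in \<open>U\<close>. Intersecting also with the set of x with - x in
  \<open>B\<close> covers differences, and local convexity then shrinks the result to a convex
  set.\<close>

lemma convex_neighbourhood:
  assumes U: "openin X U" "0 \<in> U"
  obtains V where "openin X V" "convex V" "0 \<in> V" "\<And>x y. x \<in> V \<Longrightarrow> y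
      \<in> V \<Longrightarrow> x + y \<in> U \<and> x - y \<in> U"
proof -
  have add: "continuous_map (prod_topology X X) X (\<lambda>(x, y). x + y)"
    using lcs by (simp add: locally_convex_space_def)
  have zero: "0 \<in> topspace X"
    using U openin_subset by blast
  have "openin (prod_topology X X) {p \<in> topspace (prod_topology X X). (case p of (x, y)
      \<Rightarrow> x + y) \<in> U}"
    by (rule openin_continuous_map_preimage[OF add U(1)])
  moreover have "(0, 0) \<in> {p \<in> topspace (prod_topology X X). (case p of (x, y)
      \<Rightarrow> x + y) \<in> U}"
    using U(2) zero by simp
  ultimately obtain A B where AB: "openin X A" "openin X B" "0 \<in> A" "0 \<in> B"
    "A \<times> B \<subseteq> {p \<in> topspace (prod_topology X X). (case p of (x, y)
        \<Rightarrow> x + y) \<in> U}"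
    unfolding openin_prod_topology_alt by meson
  define W where "W = A \<inter> B \<inter> {x \<in> topspace X. - x \<in> B}"
  have "openin X W"
    unfolding W_def using AB by (intro openin_Int openin_continuous_map_preimage[OF
        continuous_map_uminus])
  moreover have "0 \<in> W"
    using AB zero by (simp add: W_def)
  ultimately obtain V where V: "openin X V" "convex V" "0 \<in> V" "V \<subseteq> W"
    using lcs unfolding locally_convex_space_def by blast
  show ?thesis
  proof (rule that[OF V(1-3)])
    fix x y assume "x \<in> V" "y \<in> V"
    then have "(x, y) \<in> A \<times> B" "(x, - y) \<in> A \<times> B"
      using V(4) by (auto simp: W_def)
    then have "x + y \<in> U" "x + - y \<in> U"
      using AB(5) by auto
    then show "x + y \<in> U \<and> x - y \<in> U"
      by simp
  qed
qed

text \<open>A Lebesgue number argument: if s and t lie in one ball of the cover with centre x, the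
  increment is the difference of two increments from x.\<close>

lemma uniformly_continuous:
  assumes f: "continuous_map (top_of_set {0..1::real}) X f" and U: "openin X U" "0 \<in> U"
  obtains \<delta> where "0 < \<delta>" "\<And>s t. s \<in> {0..1} \<Longrightarrow> t \<in> {0..1}
      \<Longrightarrow> \<bar>s - t\<bar> < \<delta> \<Longrightarrow> f s - f t \<in> U"
proof -
  obtain V where V: "openin X V" "0 \<in> V" "\<And>x y. x \<in> V \<Longrightarrow> y \<in> V
      \<Longrightarrow> x - y \<in> U"
    using convex_neighbourhood[OF U] by metis
  have "\<exists>e>0. \<forall>s\<in>{0..1}. \<bar>s - x\<bar> < e \<longrightarrow> f s - f x
      \<in> V" if x: "x \<in> {0..1}" for x
  proof -
    have fx: "f x \<in> topspace X"
      using continuous_map_image_subset_topspace[OF f] x by auto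
    have "openin (top_of_set {0..1}) {s \<in> {0..1}. f s \<in> {z \<in> topspace X. z - f x \<in> V}}"
      using openin_continuous_map_preimage[OF f openin_diff_right[OF V(1) fx]] by simp
    then have "\<forall>y\<in>{s \<in> {0..1}. f s \<in> {z \<in> topspace X. z - f x \<in> V}}.
        \<exists>e>0. \<forall>s\<in>{0..1}. dist s y < e \<longrightarrow>
        s \<in> {s \<in> {0..1}. f s \<in> {z \<in> topspace X. z - f x \<in> V}}"
      unfolding openin_euclidean_subtopology_iff by (rule conjunct2)
    from bspec[OF this, of x] show ?thesis
      using x fx V(2) by (auto simp: dist_real_def)
  qed
  then obtain e where e: "\<And>x. x \<in> {0..1} \<Longrightarrow> 0 < e x"
    "\<And>x s. x \<in> {0..1} \<Longrightarrow> s \<in> {0..1} \<Longrightarrow> \<bar>s - x\<bar>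
        < e x \<Longrightarrow> f s - f x \<in> V"
    by metis
  obtain \<delta> where \<delta>: "0 < \<delta>" "\<And>s. s \<in> {0..1} \<Longrightarrow>
      \<exists>B\<in>(\<lambda>x. ball x (e x)) ` {0..1}. ball s \<delta> \<subseteq> B"
  proof (rule Heine_Borel_lemma[of "{0..1::real}" "(\<lambda>x. ball x (e x)) ` {0..1}"])
    show "{0..1} \<subseteq> \<Union>((\<lambda>x. ball x (e x)) ` {0..1})"
      using e(1) by force
  qed auto
  show ?thesis
  proof (rule that[OF \<delta>(1)])
    fix s t :: real assume st: "s \<in> {0..1}" "t \<in> {0..1}" "\<bar>s - t\<bar> < \<delta>"
    obtain x where x: "x \<in> {0..1}" "ball s \<delta> \<subseteq> ball x (e x)"
      using \<delta>(2)[OF st(1)] by blast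
    have "s \<in> ball x (e x)" "t \<in> ball x (e x)"
      using x(2) st(3) \<delta>(1) by (auto simp: subset_iff dist_real_def)
    then have "f s - f x \<in> V" "f t - f x \<in> V"
      using e(2)[OF x(1)] st by (auto simp: dist_real_def abs_minus_commute)
    from V(3)[OF this] show "f s - f t \<in> U"
      by simp
  qed
qed

end

text \<open>Left-endpoint sums on dyadic partitions of the unit interval: each partition refines the
  earlier ones, and the equal weights add up to 1, so sums are convex combinations.\<close>

definition riemann_sum :: "(real \<Rightarrow> 'a::real_vector) \<Rightarrow> nat \<Rightarrow> 'a"
  where "riemann_sum f n = (\<Sum>k<2 ^ n. (1 / 2 ^ n) *\<^sub>R f (real k / 2 ^ n))"

lemma convex_average:
  assumes "convex V" "\<And>k. k < N \<Longrightarrow> y k \<in> V" "0 < N"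
  shows "(\<Sum>k<N. (1 / real N) *\<^sub>R y k) \<in> V"
  by (rule convex_sum) (use assms in auto)

text \<open>The quotient by 2^(m - n) is the index of the coarse cell containing the fine cell k. On
  a common grid the difference of two sums becomes a single average.\<close>

lemma riemann_sum_refine:
  assumes "n \<le> m"
  shows "riemann_sum f n = (\<Sum>k<2 ^ m. (1 / 2 ^ m) *\<^sub>R f (real (k div 2 ^ (m - n)) / 2 ^ n))"
proof -
  define M :: nat where "M = 2 ^ (m - n)"
  have M: "0 < M"
    by (simp add: M_def)
  have pow: "(2::nat) ^ m = 2 ^ n * M" "(2::real) ^ m = 2 ^ n * real M"
    using assms by (simp_all add: M_def flip: power_add)
  have "(\<Sum>k<2 ^ m. (1 / 2 ^ m) *\<^sub>R f (real (k div M) / 2 ^ n))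
      = (\<Sum>i<2 ^ n. \<Sum>k\<in>{i * M..<i * M + M}. (1 / 2 ^ m) *\<^sub>R f (real (k div M) /
          2 ^ n))"
    unfolding pow(1) by (rule sum.nat_group[symmetric])
  also have "\<dots> = (\<Sum>i<2 ^ n. \<Sum>k\<in>{i * M..<i * M + M}. (1 / 2 ^ m) *\<^sub>R f
      (real i / 2 ^ n))"
  proof (intro sum.cong refl)
    fix i k assume k: "k \<in> {i * M..<i * M + M}"
    have "k div M = i"
      by (rule div_nat_eqI) (use k in \<open>auto simp: mult.commute\<close>)
    then show "(1 / 2 ^ m) *\<^sub>R f (real (k div M) / 2 ^ n) = (1 / 2 ^ m) *\<^sub>R f (real i /
        2 ^ n)"
      by simp
  qed
  also have "\<dots> = riemann_sum f n"
    using M by (simp add: riemann_sum_def pow(2) sum_constant_scaleR)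
  finally show ?thesis
    by (simp add: M_def)
qed

context seq_complete_lcs
begin

lemma riemann_sum_in_carrier:
  assumes "continuous_map (top_of_set {0..1}) X f"
  shows "riemann_sum f n \<in> topspace X"
  unfolding riemann_sum_def
proof (intro subspace_sum[OF subspace_carrier] subspace_scale[OF subspace_carrier])
  fix k assume "k \<in> {..<(2::nat) ^ n}"
  then have "real k \<le> 2 ^ n"
    by (metis lessThan_iff less_imp_le of_nat_le_iff of_nat_numeral of_nat_power)
  then show "f (real k / 2 ^ n) \<in> topspace X"
    using continuous_map_image_subset_topspace[OF assms] by auto
qed

text \<open>On the finer grid the difference from the sum of level \<open>N\<close> is an average of
  small increments of \<open>f\<close>, and a convex neighbourhood contains such averages. Two late
  sums are compared through level \<open>N\<close>; sequential completeness then gives the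
  limit.\<close>

lemma riemann_sum_converges:
  assumes f: "continuous_map (top_of_set {0..1}) X f"
  obtains l where "limitin X (riemann_sum f) l sequentially"
proof -
  have "\<exists>N. \<forall>i\<ge>N. \<forall>j\<ge>N. riemann_sum f i - riemann_sum f j \<in> U"
      if U: "openin X U" "0 \<in> U" for U
  proof -
    obtain V where V: "openin X V" "convex V" "0 \<in> V" "\<And>x y. x \<in> V \<Longrightarrow> y
        \<in> V \<Longrightarrow> x + y \<in> U \<and> x - y \<in> U"
      using convex_neighbourhood[OF U] by blast
    obtain \<delta> where \<delta>: "0 < \<delta>" "\<And>s t. s \<in> {0..1} \<Longrightarrow> t
        \<in> {0..1} \<Longrightarrow> \<bar>s - t\<bar> < \<delta> \<Longrightarrow> f s - f t \<in> V"
      using uniformly_continuous[OF f V(1,3)] by blast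
    obtain N :: nat where N: "(1 / 2) ^ N < \<delta>"
      using real_arch_pow_inv[OF \<delta>(1), of "1/2"] by auto
    have step: "riemann_sum f N - riemann_sum f m \<in> V" if m: "N \<le> m" for m
    proof -
      define M :: nat where "M = 2 ^ (m - N)"
      have M: "0 < M" by (simp add: M_def)
      have pow: "(2::nat) ^ m = 2 ^ N * M" "(2::real) ^ m = 2 ^ N * real M"
        using m by (simp_all add: M_def flip: power_add)
      have "riemann_sum f N - riemann_sum f m
          = (\<Sum>k<2 ^ m. (1 / real (2 ^ m)) *\<^sub>R (f (real (k div M) / 2 ^ N) - f (real k /
              2 ^ m)))"
        unfolding riemann_sum_refine[OF m]
        by (simp add: riemann_sum_def[of f m] M_def scaleR_diff_right sum_subtractf)
      also have "\<dots> \<in> V"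
      proof (rule convex_average[OF V(2)])
        fix k :: nat assume k: "k < 2 ^ m"
        have aux: "\<bar>p - q\<bar> < e" if "c \<le> d" "q - p = c" "0 \<le> c" "d < e" for p q c
            d e :: real
          using that by linarith
        have aux': "p \<le> q" if "q - p = c" "0 \<le> c" for p q c :: real
          using that by linarith
        have div: "real M * real (k div M) + real (k mod M) = real k"
          by (metis mult_div_mod_eq of_nat_add of_nat_mult)
        have mod: "0 \<le> real (k mod M)" "real (k mod M) < real M"
          using M by simp_all
        have lt: "real k < 2 ^ N * real M"
          using k unfolding pow(2)[symmetric] by (metis of_nat_less_iff of_nat_numeral of_nat_power)
        \<comment> \<open>A fine node lies beyond the left end of its coarse cell by the fraction (k
          mod M) / M of the coarse mesh, hence by less than delta.\<close>
        have eq: "real k / 2 ^ m - real (k div M) / 2 ^ N = real (k mod M) / real M * (1 / 2) ^ N"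
          using M unfolding pow(2) div[symmetric] by (simp add: field_simps power_divide)
        have nonneg: "0 \<le> real (k mod M) / real M * (1 / 2) ^ N"
          by simp
        have "real (k mod M) / real M \<le> 1"
          using mod M by simp
        then have "real (k mod M) / real M * (1 / 2) ^ N \<le> (1 / 2) ^ N"
          using mult_right_mono[of "real (k mod M) / real M" 1 "(1 / 2) ^ N"] by simp
        then have close: "\<bar>real (k div M) / 2 ^ N - real k / 2 ^ m\<bar> < \<delta>"
          using aux[OF _ eq nonneg N] by blast
        have le: "real (k div M) / 2 ^ N \<le> real k / 2 ^ m"
          using aux'[OF eq nonneg] .
        have le1: "real k / 2 ^ m \<le> 1"
          using lt M by (simp add: pow(2))
        show "f (real (k div M) / 2 ^ N) - f (real k / 2 ^ m) \<in> V"
          by (intro \<delta>(2) close, unfold atLeastAtMost_iff)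
            (intro conjI divide_nonneg_nonneg le1 order_trans[OF le le1]; simp)+
      qed simp
      finally show ?thesis .
    qed
    have "riemann_sum f i - riemann_sum f j \<in> U" if "N \<le> i" "N \<le> j" for i j
      using V(4)[OF step[OF that(2)] step[OF that(1)]] by simp
    then show ?thesis
      by blast
  qed
  then show ?thesis
    using complete riemann_sum_in_carrier[OF f] that unfolding sequentially_complete_def by blast
qed

end

text \<open>The increment h 1 - h 0 telescopes over the cells. On each cell uniform continuity of
  \<open>h'\<close> bounds the linearization error by e/2 times the mesh.\<close>

lemma riemann_sum_scalar:
  fixes h :: "real \<Rightarrow> complex"
  assumes h: "\<And>x. x \<in> {0..1} \<Longrightarrow> (h has_vector_derivative h' x) (at x within
      {0..1})"
    and cont: "continuous_on {0..1} h'"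
  shows "riemann_sum h' \<longlonglongrightarrow> h 1 - h 0"
proof (rule LIMSEQ_I)
  fix e :: real assume e: "0 < e"
  have "uniformly_continuous_on {0..1} h'"
    by (rule compact_uniformly_continuous[OF cont]) simp
  then obtain \<delta> where \<delta>: "0 < \<delta>"
    "\<And>s t. s \<in> {0..1} \<Longrightarrow> t \<in> {0..1} \<Longrightarrow> dist s t <
        \<delta> \<Longrightarrow> dist (h' s) (h' t) < e / 2"
    using e unfolding uniformly_continuous_on_def by (metis half_gt_zero)
  obtain N :: nat where N: "(1 / 2) ^ N < \<delta>"
    using real_arch_pow_inv[OF \<delta>(1), of "1/2"] by auto
  show "\<exists>N. \<forall>n\<ge>N. norm (riemann_sum h' n - (h 1 - h 0)) < e"
  proof (intro exI allI impI)
    fix n assume n: "N \<le> n"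
    define x where "x k = real k / 2 ^ n" for k
    have step: "x (Suc k) - x k = 1 / 2 ^ n" for k
      by (simp add: x_def field_simps)
    have small: "1 / 2 ^ n < \<delta>"
    proof -
      have "(1 / 2 :: real) ^ n \<le> (1 / 2) ^ N"
        using n by (intro power_decreasing) auto
      then show ?thesis
        using N by (simp add: power_divide)
    qed
    have "h 1 - h 0 = (\<Sum>k<2 ^ n. h (x (Suc k)) - h (x k))"
      by (subst sum_lessThan_telescope) (simp add: x_def)
    then have "norm (riemann_sum h' n - (h 1 - h 0))
        = norm (\<Sum>k<2 ^ n. h (x (Suc k)) - h (x k) - (1 / 2 ^ n) *\<^sub>R h' (x k))"
      by (simp add: riemann_sum_def x_def sum_subtractf norm_minus_commute)
    also have "\<dots> \<le> (\<Sum>k<(2::nat) ^ n. (1 / 2 ^ n) * (e / 2))"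
    proof (rule sum_norm_le)
      fix k assume "k \<in> {..<(2::nat) ^ n}"
      then have k: "Suc k \<le> 2 ^ n"
        by simp
      then have "real (Suc k) \<le> 2 ^ n"
        by (metis of_nat_le_iff of_nat_numeral of_nat_power)
      with k have x01: "{x k..x (Suc k)} \<subseteq> {0..1}" and mem: "x k \<in> {0..1}"
        by (auto simp: x_def field_simps)
      have le: "x k \<le> x (Suc k)"
        by (simp add: x_def divide_right_mono)
      have "norm (h (x (Suc k)) - h (x k) - (x (Suc k) - x k) *\<^sub>R h' (x k)) \<le> norm (x
          (Suc k) - x k) * (e / 2)"
      proof (rule vector_differentiable_bound_linearization[where S = "{x k..x (Suc k)}"])
        show "closed_segment (x k) (x (Suc k)) \<subseteq> {x k..x (Suc k)}"
          using le by (simp add: closed_segment_eq_real_ivl)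
        show "x k \<in> {x k..x (Suc k)}"
          using le by simp
      next
        fix y assume y: "y \<in> {x k..x (Suc k)}"
        show "(h has_vector_derivative h' y) (at y within {x k..x (Suc k)})"
          using h x01 y by (blast intro: has_vector_derivative_within_subset)
        have "dist y (x k) < \<delta>"
          using y step[of k] small by (auto simp: dist_real_def)
        then show "norm (h' y - h' (x k)) \<le> e / 2"
          using \<delta>(2)[of y "x k"] x01 y mem by (auto simp: dist_norm)
      qed
      then show "norm (h (x (Suc k)) - h (x k) - (1 / 2 ^ n) *\<^sub>R h' (x k)) \<le> (1 / 2 ^ n)
          * (e / 2)"
        by (simp add: step)
    qed
    also have "\<dots> < e"
      using e by simp
    finally show "norm (riemann_sum h' n - (h 1 - h 0)) < e" .
  qed
qed

section \<open>Orbits in the space \<open>E\<close>\<close>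

text \<open>The hypothesis \<open>mean\<close> presents the difference quotient of u over [a, b] as
  the average of \<open>F\<close>. Near t all values of \<open>F\<close> are close to
  \<open>F t\<close>, and by convexity so are the Riemann sums.\<close>

lemma (in seq_complete_lcs) has_derivative_in_riemann:
  assumes F: "continuous_map (top_of_set {0..}) X F"
    and mean: "\<And>a b. 0 \<le> a \<Longrightarrow> a < b \<Longrightarrow>
      limitin X (riemann_sum (\<lambda>x. F (a + (b - a) * x))) ((1 / (b - a)) *\<^sub>R (u b - u
          a)) sequentially"
    and t: "0 \<le> t"
  shows "has_derivative_in X u (F t) t"
  unfolding has_derivative_in_def limitin_def
proof (intro conjI allI impI)
  show Ft: "F t \<in> topspace X"
    using continuous_map_image_subset_topspace[OF F] t by auto
  fix U assume U: "openin X U \<and> F t \<in> U"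
  define U0 where "U0 = {x \<in> topspace X. F t + x \<in> U}"
  have "openin X U0" "0 \<in> U0"
    using openin_continuous_map_preimage[OF continuous_map_add_const[OF Ft]] U subspace_0[OF
        subspace_carrier]
    by (auto simp: U0_def)
  then obtain V where V: "openin X V" "convex V" "0 \<in> V" "\<And>x y. x \<in> V
      \<Longrightarrow> y \<in> V \<Longrightarrow> x + y \<in> U0"
    using convex_neighbourhood by metis
  have "openin (top_of_set {0..}) {s \<in> {0..}. F s \<in> {z \<in> topspace X. z - F t \<in> V}}"
    using openin_continuous_map_preimage[OF F openin_diff_right[OF V(1) Ft]] by simp
  then have "\<forall>y\<in>{s \<in> {0..}. F s \<in> {z \<in> topspace X. z - F t \<in> V}}.
      \<exists>e>0. \<forall>s\<in>{0..}. dist s y < e \<longrightarrow>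
      s \<in> {s \<in> {0..}. F s \<in> {z \<in> topspace X. z - F t \<in> V}}"
    unfolding openin_euclidean_subtopology_iff by (rule conjunct2)
  from bspec[OF this, of t] obtain \<delta> where \<delta>: "0 < \<delta>" "\<And>s. 0 \<le> s
      \<Longrightarrow> \<bar>s - t\<bar> < \<delta> \<Longrightarrow> F s - F t \<in> V"
    using t Ft V(3) by (auto simp: dist_real_def)
  have mean_U: "(1 / (b - a)) *\<^sub>R (u b - u a) \<in> U"
    if ab: "0 \<le> a" "a < b" "\<bar>a - t\<bar> < \<delta>" "\<bar>b - t\<bar> < \<delta>" for a b
  proof -
    let ?l = "(1 / (b - a)) *\<^sub>R (u b - u a)" and ?R = "riemann_sum (\<lambda>x. F (a + (b -
        a) * x))"
    have l: "limitin X ?R ?l sequentially"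
      by (rule mean) (use ab in auto)
    then have l_carrier: "?l \<in> topspace X"
      by (rule limitin_topspace)
    \<comment> \<open>A single Riemann sum close to its limit suffices; the two errors, each in
      \<open>V\<close>, add up to an element of \<open>U0\<close>.\<close>
    have "eventually (\<lambda>n. ?R n \<in> {x \<in> topspace X. ?l - x \<in> V}) sequentially"
      by (rule limitinD[OF l openin_diff_left[OF V(1) l_carrier]]) (use l_carrier V(3) in simp)
    then obtain n where n: "?l - ?R n \<in> V"
      by (auto simp: eventually_sequentially)
    have "?R n - F t = (\<Sum>k<2 ^ n. (1 / real (2 ^ n)) *\<^sub>R (F (a + (b - a) * (real k / 2 ^
        n)) - F t))"
      by (simp add: riemann_sum_def scaleR_diff_right sum_subtractf sum_constant_scaleR)
    also have "\<dots> \<in> V"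
    proof (rule convex_average[OF V(2)])
      fix k :: nat assume "k < 2 ^ n"
      then have "k \<le> 2 ^ n" by simp
      then have "real k \<le> 2 ^ n"
        by (metis of_nat_le_iff of_nat_numeral of_nat_power)
      define x where "x = real k / 2 ^ n"
      have x: "0 \<le> x" "x \<le> 1"
        using \<open>real k \<le> 2 ^ n\<close> by (simp_all add: x_def)
      have "0 \<le> (b - a) * x"
        using x ab by simp
      moreover have "(b - a) * x \<le> b - a"
        using mult_left_mono[OF x(2), of "b - a"] ab by simp
      ultimately have "0 \<le> a + (b - a) * x" "\<bar>a + (b - a) * x - t\<bar> < \<delta>"
        using ab by linarith+
      then show "F (a + (b - a) * (real k / 2 ^ n)) - F t \<in> V"
        unfolding x_def[symmetric] by (rule \<delta>(2))
    qed simp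
    finally have "?l - F t \<in> U0"
      using V(4)[OF n] by fastforce
    then show ?thesis
      by (simp add: U0_def)
  qed
  have "eventually (\<lambda>s. s \<noteq> t \<and> 0 \<le> s \<and> \<bar>s - t\<bar> < \<delta>)
      (at t within {0..})"
    using \<delta>(1) unfolding eventually_at by (intro exI[of _ \<delta>]) (auto simp: dist_real_def)
  then show "eventually (\<lambda>s. (1 / (s - t)) *\<^sub>R (u s - u t) \<in> U) (at t within {0..})"
  proof (rule eventually_mono)
    fix s assume s: "s \<noteq> t \<and> 0 \<le> s \<and> \<bar>s - t\<bar> < \<delta>"
    show "(1 / (s - t)) *\<^sub>R (u s - u t) \<in> U"
    proof (cases "t < s")
      case True
      then show ?thesis
        using mean_U[of t s] s t \<delta>(1) by simp
    next
      case False
      then have "(1 / (t - s)) *\<^sub>R (u t - u s) \<in> U"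
        using mean_U[of s t] s \<delta>(1) by simp
      \<comment> \<open>The quotient is symmetric in s and t, so points to the left of t use the
        interval [s, t].\<close>
      also have "(1 / (t - s)) *\<^sub>R (u t - u s) = (1 / (s - t)) *\<^sub>R (u s - u t)"
      proof -
        have "1 / (t - s) = - (1 / (s - t))"
          by (metis minus_diff_eq minus_divide_right)
        then show ?thesis
          by (simp only: scaleR_minus_left minus_diff_eq flip: scaleR_minus_right)
      qed
      finally show ?thesis .
    qed
  qed
qed

locale semigroup_space = convolution_semigroup S G + seq_complete_lcs X
  for S :: "real \<Rightarrow> 'n::finite tempered ^ 'm::finite ^ 'm" and G and X :: "('n tempered
      ^ 'm) topology" +
  assumes embedding: "continuous_map X tempered_vec_topology (\<lambda>u. u)"
    and orbit: "u \<in> topspace X \<Longrightarrow> continuous_map (top_of_set {0..}) X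
        (\<lambda>t. conv_vec (S t) u)"
begin

lemma limitin_carrier_weak:
  assumes "limitin X f l F"
  shows "((\<lambda>x. apply_dist (f x $ i) \<phi>) \<longlongrightarrow> apply_dist (l $ i) \<phi>) F"
  using continuous_map_limit[OF embedding assms]
  by (intro strong_limit_weak limitin_vec_nth) (simp add: o_def)

text \<open>Completeness provides the limit of the Riemann sums inside \<open>X\<close>, but not its
  value. The value is found after embedding, where the scalar fundamental theorem applies to every
  component and test function.\<close>

lemma orbit_derivative:
  assumes w: "w \<in> topspace X" "apply_system G w \<in> topspace X" and t: "0 \<le> t"
  shows "has_derivative_in X (\<lambda>t. conv_vec (S t) w) (conv_vec (S t) (apply_system G w)) t"
proof (rule has_derivative_in_riemann[OF orbit[OF w(2)] _ t])
  fix a b :: real assume ab: "0 \<le> a" "a < b"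
  let ?f = "\<lambda>x. conv_vec (S (a + (b - a) * x)) (apply_system G w)"
  let ?q = "(1 / (b - a)) *\<^sub>R (conv_vec (S b) w - conv_vec (S a) w)"
  have range: "0 \<le> a + (b - a) * x" if "x \<in> {0..1}" for x
    using ab that by simp
  have "continuous_map (top_of_set {0..1}) (top_of_set {0..}) (\<lambda>x. a + (b - a) * x)"
    using range by (auto simp: continuous_map_in_subtopology intro!: continuous_intros)
  from continuous_map_compose[OF this orbit[OF w(2)]]
  have "continuous_map (top_of_set {0..1}) X ?f"
    by (simp add: o_def)
  then obtain l where l: "limitin X (riemann_sum ?f) l sequentially"
    using riemann_sum_converges by blast
  have "apply_dist (l $ i) \<phi> = apply_dist (?q $ i) \<phi>" for i \<phi>
  proof -
    let ?g = "\<lambda>\<tau>. apply_dist (conv_vec (S \<tau>) w $ i) \<phi>"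
    let ?g' = "\<lambda>\<tau>. apply_dist (conv_vec (S \<tau>) (apply_system G w) $ i) \<phi>"
    have "continuous_on {0..} ?g'"
      unfolding continuous_on_eq_continuous_within
      using derivative_S[of _ "apply_system G w" i \<phi>] by (auto intro:
          has_vector_derivative_continuous)
    then have cont: "continuous_on {0..1} (\<lambda>x. ?g' (a + (b - a) * x))"
      by (rule continuous_on_compose2) (use range in \<open>auto intro!: continuous_intros\<close>)
    \<comment> \<open>Dividing by b - a cancels the chain rule factor of the substitution, so the
      integrand is exactly the derivative.\<close>
    have "((\<lambda>x. (1 / (b - a)) *\<^sub>R ?g (a + (b - a) * x)) has_vector_derivative ?g' (a
        + (b - a) * x))
        (at x within {0..1})" if x: "x \<in> {0..1}" for x
    proof -
      have "((\<lambda>x. a + (b - a) * x) has_vector_derivative (b - a)) (at x within {0..1})"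
        by (auto intro!: derivative_eq_intros)
      moreover have "(?g has_vector_derivative ?g' (a + (b - a) * x))
          (at (a + (b - a) * x) within (\<lambda>x. a + (b - a) * x) ` {0..1})"
        by (rule has_vector_derivative_within_subset[OF derivative_S]) (use range x in auto)
      ultimately have "((\<lambda>x. ?g (a + (b - a) * x)) has_vector_derivative (b - a) *\<^sub>R
          ?g' (a + (b - a) * x))
          (at x within {0..1})"
        using vector_diff_chain_within[of "\<lambda>x. a + (b - a) * x" "b - a" x "{0..1}" ?g] by
            (simp add: o_def)
      from has_vector_derivative_scaleR[OF DERIV_const[of "1 / (b - a)"] this]
      show ?thesis
        using ab by simp
    qed
    from riemann_sum_scalar[OF this cont]
    have "riemann_sum (\<lambda>x. ?g' (a + (b - a) * x)) \<longlonglongrightarrow> apply_dist (?q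
        $ i) \<phi>"
      by (simp add: scaleR_conv_of_real right_diff_distrib del: of_real_divide of_real_diff)
    moreover have "riemann_sum (\<lambda>x. ?g' (a + (b - a) * x)) = (\<lambda>n. apply_dist
        (riemann_sum ?f n $ i) \<phi>)"
      by (simp add: fun_eq_iff riemann_sum_def sum_component scaleR_conv_of_real)
    ultimately show ?thesis
      using limitin_carrier_weak[OF l, of i \<phi>] LIMSEQ_unique by fastforce
  qed
  then have "l = ?q"
    by (simp add: vec_eq_iff tempered_eqI)
  with l show "limitin X (riemann_sum ?f) ?q sequentially"
    by simp
qed

end

section \<open>Iterates of the operator and the solution of the Cauchy problem\<close>

lemma domain_power_funpow:
  "u \<in> domain_power E G k \<Longrightarrow> j \<le> k \<Longrightarrow> (apply_system G ^^ j) u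
      \<in> E"
proof (induction k arbitrary: u j)
  case (Suc k)
  show ?case
  proof (cases j)
    case 0
    then show ?thesis
      using Suc.prems by (simp add: domain_in_def)
  next
    case (Suc i)
    then show ?thesis
      using Suc.prems Suc.IH[of "apply_system G u" i] by (simp add: funpow_Suc_right del: funpow.simps)
  qed
qed simp

lemma domain_epower_funpow:
  assumes "u \<in> domain_epower E G k" "enat j \<le> k"
  shows "(apply_system G ^^ j) u \<in> E"
proof (cases k)
  case (enat n)
  then show ?thesis
    using assms domain_power_funpow[of u E G n j] by (simp add: domain_epower_def)
next
  case infinity
  \<comment> \<open>The index is \<open>Suc j\<close> because the intersection starts at 1, while j
    may be 0.\<close>
  then have "u \<in> domain_power E G (Suc j)"
    using assms by (auto simp: domain_epower_def simp del: domain_power.simps)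
  then show ?thesis
    by (rule domain_power_funpow) simp
qed

theorem theorem5:
  fixes G :: "'n::finite polynomial ^ 'm::finite ^ 'm"
    and S :: "real \<Rightarrow> 'n tempered ^ 'm ^ 'm"
    and E :: "('n tempered ^ 'm) set"
    and X :: "('n tempered ^ 'm) topology"
    and k :: enat
    and u\<^sub>0 :: "'n tempered ^ 'm"
  assumes "bdd_above {Re z | z \<xi>. z \<in> matrix_spectrum (symbol G \<xi>)}"
    and "idcs S"
    and "generating_distribution S (system_dirac G)"
    and "topspace X = E"
    and "locally_convex_space X"
    and "sequentially_complete X"
    and "continuous_map X tempered_vec_topology (\<lambda>u. u)"
    and "\<And>t u. 0 \<le> t \<Longrightarrow> u \<in> E \<Longrightarrow> conv_vec (S t) u \<in> E"
    and "\<And>t. 0 \<le> t \<Longrightarrow> continuous_map X X (\<lambda>u. conv_vec (S t) u)"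
    and "\<And>u. u \<in> E \<Longrightarrow> continuous_map (top_of_set {0..}) X (\<lambda>t.
        conv_vec (S t) u)"
    and "1 \<le> k"
    and "u\<^sub>0 \<in> domain_epower E G k"
  shows "\<exists>u. C_k_in X k u \<and> solves_cauchy_in X G u\<^sub>0 u \<and>
    (\<forall>v. C_k_in tempered_vec_topology 1 v \<and> solves_cauchy_in tempered_vec_topology G
        u\<^sub>0 v \<longrightarrow>
      (\<forall>t\<ge>0. v t = u t)) \<and>
    (\<forall>t\<ge>0. u t = conv_vec (S t) u\<^sub>0)"
proof -
  interpret semigroup_space S G X
    by unfold_locales (use assms in auto)
  define w where "w j = (apply_system G ^^ j) u\<^sub>0" for j
  have w: "w j \<in> topspace X" if "enat j \<le> k" for j
    using domain_epower_funpow[OF assms(12) that] assms(4) by (simp add: w_def)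
  have w_Suc: "apply_system G (w j) = w (Suc j)" for j
    by (simp add: w_def)
  have deriv: "has_derivative_in X (\<lambda>t. conv_vec (S t) (w j)) (conv_vec (S t) (w (Suc j))) t"
    if "enat j < k" "0 \<le> t" for j t
  proof -
    have "enat (Suc j) \<le> k"
      using that(1) by (simp add: Suc_ile_eq)
    then show ?thesis
      using orbit_derivative[OF w[OF less_imp_le[OF that(1)]] _ that(2)] w by (simp add: w_Suc)
  qed
  let ?u = "\<lambda>t. conv_vec (S t) u\<^sub>0"
  have "C_k_in X k ?u"
    \<comment> \<open>The witness for the derivative of order j is the orbit of the j-th iterate of
      the system applied to the initial value, which lies in the space whenever j <= k.\<close>
    unfolding C_k_in_def
    by (intro exI[of _ "\<lambda>j t. conv_vec (S t) (w j)"] conjI allI impI orbit w deriv)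
      (simp_all add: w_def)
  moreover have "solves_cauchy_in X G u\<^sub>0 ?u"
  proof -
    \<comment> \<open>With k at least 1 the orbit has a first derivative in \<open>X\<close>;
      commuting the system with the semigroup turns this derivative into the right-hand side of the
      equation.\<close>
    have "enat 0 < k"
      using assms(11) by (metis less_le_trans one_enat_def zero_enat_def zero_less_one)
    then show ?thesis
      using deriv[of 0] by (simp add: solves_cauchy_in_def S_zero apply_system_conv_vec w_def)
  qed
  ultimately show ?thesis
    using cauchy_solution_unique by (intro exI[of _ ?u]) auto
qed

end
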